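(* Let $d \geq 5$ and let $\mu$ be the limiting uniform spanning forest measure on subgraphs of $\mathbf{Z}^d$. Then $\mu$ concentrates on spanning forests each of whose components has one or two topological ends.
   Context: $\mathbf{Z}^d$ denotes the nearest neighbor graph on the $d$-dimensional integer lattice. Subgraphs of $\mathbf{Z}^d$ are subcollections of its edges, viewed as elements of $\{0,1\}^{\text{edges}}$ with the product topology and Borel $\sigma$-field. A spanning forest of $\mathbf{Z}^d$ is a cycle-free subgraph containing at least one edge incident to each vertex of $\mathbf{Z}^d$. Let $B_n$ be the box of diameter $2n$ centered at the origin, with its $(2n+1)^d$ vertices and all nearest neighbor edges between them, and let $\mu_1(B_n)$ be the uniform probability measure on spanning trees of $B_n$, viewed as a measure on subgraphs of $\mathbf{Z}^d$. The measure $\mu$ is the weak limit of $\mu_1(B_n)$ as $n\to\infty$ (i.e. $\mu_1(B_n)(C)\to\mu(C)$ for every event $C$ depending on finitely many edges); this limit exists. The number of topological ends of a tree is the number of infinite self-avoiding paths in it starting from any fixed vertex. *)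

theory Defs
  imports "HOL-Probability.Probability"
begin

text \<open>
  Graphs are simple and are given by their set of edges, an edge being an unordered pair of
  vertices, i.e. a two-element set. The vertex set of the lattice graph is the type
  \<^typ>\<open>int ^ 'd\<close>, whose dimension is the cardinality of the finite type \<^typ>\<open>'d\<close>.
\<close>

definition lattice_edges :: "(int ^ 'd::finite) set set" where
  "lattice_edges = {{x, y} | x y. (\<Sum>i\<in>UNIV. \<bar>x $ i - y $ i\<bar>) = 1}"


subsection \<open>Forests, components and ends\<close>

definition adjacency :: "'v set set \<Rightarrow> ('v \<times> 'v) set" where
  "adjacency T = {(x, y). {x, y} \<in> T}"

definition is_cycle :: "'v set set \<Rightarrow> 'v list \<Rightarrow> bool" where
  "is_cycle T vs \<longleftrightarrow> length vs \<ge> 3 \<and> distinct vs \<and>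
     (\<forall>i<length vs. {vs ! i, vs ! (Suc i mod length vs)} \<in> T)"

definition cycle_free :: "'v set set \<Rightarrow> bool" where
  "cycle_free T \<longleftrightarrow> (\<nexists>vs. is_cycle T vs)"

definition spanning_forest :: "(int ^ 'd::finite) set set \<Rightarrow> bool" where
  "spanning_forest T \<longleftrightarrow> T \<subseteq> lattice_edges \<and> cycle_free T \<and> (\<forall>x. \<exists>e\<in>T. x \<in> e)"

text \<open>Components are represented by their vertex sets.\<close>

definition components_of :: "'v set set \<Rightarrow> 'v set set" where
  "components_of T = UNIV // (adjacency T)\<^sup>*"

definition rays_from :: "'v set set \<Rightarrow> 'v \<Rightarrow> (nat \<Rightarrow> 'v) set" where
  "rays_from T x = {p. p 0 = x \<and> inj p \<and> (\<forall>i. {p i, p (Suc i)} \<in> T)}"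

text \<open>
  A component of a forest \<^term>\<open>T\<close> has \<^term>\<open>k\<close> ends if there are \<^term>\<open>k\<close> infinite self-avoiding
  paths from any of its vertices; such a path never leaves the component. The finiteness condition
  matters for \<^prop>\<open>k = 0\<close> only, since infinite sets have cardinality 0.
\<close>

definition has_ends :: "'v set set \<Rightarrow> 'v set \<Rightarrow> nat \<Rightarrow> bool" where
  "has_ends T C k \<longleftrightarrow> (\<forall>x\<in>C. finite (rays_from T x) \<and> card (rays_from T x) = k)"


subsection \<open>Random subgraphs of the lattice\<close>

text \<open>
  The edge set is countable, so the product sigma-algebra below is the Borel sigma-algebra of the
  product topology.
\<close>

definition config_space :: "((int ^ 'd::finite) set \<Rightarrow> bool) measure" where
  "config_space = (\<Pi>\<^sub>M e\<in>lattice_edges. count_space UNIV)"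

definition config_of :: "(int ^ 'd::finite) set set \<Rightarrow> (int ^ 'd) set \<Rightarrow> bool" where
  "config_of T = (\<lambda>e\<in>lattice_edges. e \<in> T)"

definition subgraph_of :: "((int ^ 'd::finite) set \<Rightarrow> bool) \<Rightarrow> (int ^ 'd) set set" where
  "subgraph_of \<omega> = {e \<in> lattice_edges. \<omega> e}"

definition finitely_determined :: "((int ^ 'd::finite) set \<Rightarrow> bool) set \<Rightarrow> bool" where
  "finitely_determined C \<longleftrightarrow> C \<in> sets config_space \<and>
     (\<exists>F. finite F \<and> F \<subseteq> lattice_edges \<and>
        (\<forall>\<omega>\<in>space config_space. \<forall>\<omega>'\<in>space config_space.
           (\<forall>e\<in>F. \<omega> e = \<omega>' e) \<longrightarrow> (\<omega> \<in> C \<longleftrightarrow> \<omega>' \<in> C)))"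


subsection \<open>Uniform spanning trees of boxes and their limit\<close>

definition box_vertices :: "nat \<Rightarrow> (int ^ 'd::finite) set" where
  "box_vertices n = {x. \<forall>i. \<bar>x $ i\<bar> \<le> int n}"

definition box_edges :: "nat \<Rightarrow> (int ^ 'd::finite) set set" where
  "box_edges n = {e \<in> lattice_edges. e \<subseteq> box_vertices n}"

definition box_spanning_trees :: "nat \<Rightarrow> (int ^ 'd::finite) set set set" where
  "box_spanning_trees n = {T. T \<subseteq> box_edges n \<and> cycle_free T \<and>
     (\<forall>x\<in>box_vertices n. \<forall>y\<in>box_vertices n. (x, y) \<in> (adjacency T)\<^sup>*)}"

definition box_ust :: "nat \<Rightarrow> ((int ^ 'd::finite) set \<Rightarrow> bool) measure" where
  "box_ust n = distr (uniform_count_measure (box_spanning_trees n)) config_space config_of"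

definition is_limiting_usf :: "((int ^ 'd::finite) set \<Rightarrow> bool) measure \<Rightarrow> bool" where
  "is_limiting_usf \<mu> \<longleftrightarrow> prob_space \<mu> \<and> sets \<mu> = sets config_space \<and>
     (\<forall>C. finitely_determined C \<longrightarrow> (\<lambda>n. measure (box_ust n) C) \<longlonglongrightarrow> measure \<mu> C)"

end

theory Submission
  imports Defs
begin

text \<open>
  The limiting measure is translation invariant, and a translation-invariant random forest of
  the lattice cannot contain a vertex from which three disjoint infinite branches emanate. These
  two facts give the bound of two ends; the bound of at least one end holds because components
  are infinite and locally finite.

  Translation invariance comes from monotonicity of the inclusion probabilities of uniform spanning
  trees: if a finite connected graph is enlarged, the probability that a given edge set \<open>F\<close>
  belongs to the tree can only decrease (\<open>num_trees_mono\<close>). Since a translate of a box is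
  squeezed between two concentric boxes, and both squeezing sequences have the same limit, the
  limiting probability of \<open>F\<close> equals that of its translates. These events generate the
  sigma-algebra and are closed under intersection.

  For the monotonicity it suffices to add the edges of \<open>F\<close> one at a time, that is, to compare
  the conditional probability of an edge \<open>{a, b}\<close> given that the tree contains \<open>A\<close>. By
  Kirchhoff, this is the effective resistance between \<open>a\<close> and \<open>b\<close> after contraction of
  \<open>A\<close>. The potential of the corresponding current counts spanning forests with two components
  (\<open>potential\<close>), and the current satisfies the node law because it is the average over
  spanning trees of the unit flow along the tree path from \<open>a\<close> to \<open>b\<close>
  (\<open>sum_path_edges\<close>, \<open>sum_potential\<close>). Monotonicity of effective resistance is then an
  application of the Cauchy-Schwarz inequality (\<open>num_trees_insert_mono\<close>).

  The bound on the number of ends is the density argument of Burton and Keane. Call an edge of a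
  forest a core edge if both components left by its removal are infinite, and a vertex a branch
  point if it has at least three core edges. Three rays from one vertex produce a branch point
  (\<open>branch_point_three_rays\<close>). No vertex has exactly one core edge (\<open>core_no_leaf\<close>), and a
  finite forest has at most as many edges as vertices, so the number of branch points in a finite
  set is at most twice the size of its outer boundary (\<open>card_branch_points_le\<close>). For boxes the boundary is
  of smaller order than the volume, while translation invariance gives every vertex the same
  probability of being a branch point; hence this probability is zero
  (\<open>prob_branch_point_zero\<close>). Acyclicity and the absence of finite components pass from the box
  trees to the limit because each violation is witnessed by finitely many edges.
\<close>

section \<open>Connectivity and acyclicity\<close>

definition conn :: "'v set set \<Rightarrow> 'v \<Rightarrow> 'v \<Rightarrow> bool" where
  "conn T x y \<longleftrightarrow> (x, y) \<in> (adjacency T)\<^sup>*"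

definition simple_edges :: "'v set set \<Rightarrow> bool" where
  "simple_edges T \<longleftrightarrow> (\<forall>e\<in>T. \<exists>x y. x \<noteq> y \<and> e = {x, y})"

lemma conn_refl [simp]: "conn T x x"
  by (simp add: conn_def)

lemma conn_sym: "conn T x y \<Longrightarrow> conn T y x"
proof -
  have "sym (adjacency T)" by (auto simp: sym_def adjacency_def insert_commute)
  then show "conn T x y \<Longrightarrow> conn T y x" unfolding conn_def by (meson sym_rtrancl symE)
qed

lemma conn_trans: "conn T x y \<Longrightarrow> conn T y z \<Longrightarrow> conn T x z"
  by (auto simp: conn_def)

lemma conn_edge: "{x, y} \<in> T \<Longrightarrow> conn T x y"
  by (auto simp: conn_def adjacency_def)

lemma conn_step: "conn T x y \<Longrightarrow> {y, z} \<in> T \<Longrightarrow> conn T x z"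
  using conn_edge conn_trans by metis

lemma conn_mono: "conn S x y \<Longrightarrow> S \<subseteq> T \<Longrightarrow> conn T x y"
  unfolding conn_def by (rule subsetD[OF rtrancl_mono]) (auto simp: adjacency_def)

lemma conn_induct [consumes 1, case_names refl step]:
  assumes "conn T x y" and "P x" and "\<And>y z. conn T x y \<Longrightarrow> {y, z} \<in> T \<Longrightarrow> P y \<Longrightarrow> P z"
  shows "P y"
  using assms(1) unfolding conn_def
  by (induction rule: rtrancl_induct) (use assms in \<open>auto simp: conn_def adjacency_def\<close>)

text \<open>
  A walk using the new edge can be cut at the first and at the last traversal.
\<close>

lemma conn_insert:
  assumes "conn (insert {x, y} T) p q"
  shows "conn T p q \<or> (conn T p x \<and> conn T y q) \<or> (conn T p y \<and> conn T x q)"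
  using assms
proof (induction rule: conn_induct)
  case (step w z)
  show ?case
  proof (cases "{w, z} \<in> T")
    case True
    then show ?thesis using step.IH conn_step by metis
  next
    case False
    then have "{w, z} = {x, y}" using step.hyps by auto
    then have "(w = x \<and> z = y) \<or> (w = y \<and> z = x)" by (auto simp: doubleton_eq_iff)
    then show ?thesis using step.IH by (auto dest: conn_sym intro: conn_trans)
  qed
qed simp

lemma conn_remove_edge:
  assumes "conn T p q"
  shows "conn (T - {{x, y}}) p q \<or> (conn (T - {{x, y}}) p x \<and> conn (T - {{x, y}}) y q)
    \<or> (conn (T - {{x, y}}) p y \<and> conn (T - {{x, y}}) x q)"
  by (rule conn_insert[where T = "T - {{x, y}}"]) (rule conn_mono[OF assms], auto)

text \<open>
  For graphs without loops this is a form of acyclicity (\<open>cycle_free_iff_no_detour\<close>) that speaks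
  of reachability only, so that later arguments need no explicit cycles or paths.
\<close>

definition no_detour :: "'v set set \<Rightarrow> bool" where
  "no_detour T \<longleftrightarrow> (\<forall>x y. {x, y} \<in> T \<longrightarrow> \<not> conn (T - {{x, y}}) x y)"

lemma no_detourD: "no_detour T \<Longrightarrow> {x, y} \<in> T \<Longrightarrow> conn (T - {{x, y}}) x y \<Longrightarrow> False"
  by (auto simp: no_detour_def)

lemma no_detour_subset: "no_detour T \<Longrightarrow> S \<subseteq> T \<Longrightarrow> no_detour S"
  unfolding no_detour_def by (meson conn_mono Diff_mono subsetD order_refl)

lemma no_detour_insert:
  assumes T: "no_detour T" and xy: "\<not> conn T x y"
  shows "no_detour (insert {x, y} T)"
  unfolding no_detour_def
proof (intro allI impI notI)
  fix p q assume pq: "{p, q} \<in> insert {x, y} T" and c: "conn (insert {x, y} T - {{p, q}}) p q"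
  show False
  proof (cases "{p, q} = {x, y}")
    case True
    then have "conn T p q" using c by (auto elim: conn_mono)
    then show False using True xy by (auto simp: doubleton_eq_iff dest: conn_sym)
  next
    case False
    then have pqT: "{p, q} \<in> T" using pq by auto
    let ?H = "T - {{p, q}}"
    have "conn (insert {x, y} ?H) p q" using c by (rule conn_mono) auto
    from conn_insert[OF this] consider "conn ?H p q" | "conn ?H p x" "conn ?H y q"
      | "conn ?H p y" "conn ?H x q" by blast
    then show False
    proof cases
      case 1
      then show ?thesis using T pqT no_detourD by metis
    next
      case 2
      then have "conn T p x" "conn T y q" by (auto elim: conn_mono)
      then show ?thesis using xy conn_edge[OF pqT] by (meson conn_sym conn_trans)
    next
      case 3
      then have "conn T p y" "conn T x q" by (auto elim: conn_mono)
      then show ?thesis using xy conn_edge[OF pqT] by (meson conn_sym conn_trans)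
    qed
  qed
qed

lemma conn_imp_distinct_path:
  assumes "conn T x y"
  shows "\<exists>vs. vs \<noteq> [] \<and> hd vs = x \<and> last vs = y \<and> distinct vs \<and>
    (\<forall>i. Suc i < length vs \<longrightarrow> {vs ! i, vs ! Suc i} \<in> T)"
  using assms
proof (induction rule: conn_induct)
  case refl
  show ?case by (rule exI[of _ "[x]"]) auto
next
  case (step w z)
  then obtain vs where vs: "vs \<noteq> []" "hd vs = x" "last vs = w" "distinct vs"
    "\<And>i. Suc i < length vs \<Longrightarrow> {vs ! i, vs ! Suc i} \<in> T" by auto
  show ?case
  proof (cases "z \<in> set vs")
    case True
    then obtain k where k: "k < length vs" "vs ! k = z" by (auto simp: in_set_conv_nth)
    have "last (take (Suc k) vs) = z" using k by (simp add: take_Suc_conv_app_nth)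
    then show ?thesis
      by (intro exI[of _ "take (Suc k) vs"]) (use vs in auto)
  next
    case False
    have "{(vs @ [z]) ! i, (vs @ [z]) ! Suc i} \<in> T" if "Suc i < length (vs @ [z])" for i
    proof (cases "Suc i < length vs")
      case True
      then show ?thesis using vs(5)[of i] by (simp add: nth_append)
    next
      case False
      then have "i = length vs - 1" using that vs(1) by (cases vs) auto
      then show ?thesis using vs(1,3) step.hyps
        by (auto simp: nth_append last_conv_nth)
    qed
    then show ?thesis
      by (intro exI[of _ "vs @ [z]"]) (use vs False in auto)
  qed
qed

lemma conn_along_list:
  assumes "\<And>i. i < k \<Longrightarrow> {f i, f (Suc i)} \<in> T"
  shows "conn T (f 0) (f k)"
  using assms
proof (induction k)
  case (Suc k)
  then show ?case by (meson conn_step less_Suc_eq)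
qed simp

text \<open>
  A detour around an edge can be shortened to a self-avoiding path, which the edge closes to a cycle;
  conversely a cycle provides a detour around each of its edges. A detour has at least three vertices
  because it avoids the edge and its ends differ.
\<close>

lemma cycle_free_iff_no_detour:
  assumes "simple_edges T"
  shows "cycle_free T \<longleftrightarrow> no_detour T"
proof
  assume cf: "cycle_free T"
  show "no_detour T" unfolding no_detour_def
  proof (intro allI impI notI)
    fix x y assume xy: "{x, y} \<in> T" and "conn (T - {{x, y}}) x y"
    from conn_imp_distinct_path[OF this(2)] obtain vs where vs: "vs \<noteq> []" "hd vs = x" "last vs = y"
      "distinct vs" "\<And>i. Suc i < length vs \<Longrightarrow> {vs ! i, vs ! Suc i} \<in> T - {{x, y}}" by auto
    have "x \<noteq> y" using xy assms by (fastforce simp: simple_edges_def)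
    have l1: "length vs \<noteq> 1" using vs \<open>x \<noteq> y\<close> by (cases vs) auto
    have l2: "length vs \<noteq> 2"
    proof
      assume l: "length vs = 2"
      then have "vs ! 0 = x" "vs ! 1 = y" using vs by (auto simp: hd_conv_nth last_conv_nth)
      then show False using vs(5)[of 0] l by auto
    qed
    have len: "length vs \<ge> 3"
      using l1 l2 vs(1) length_0_conv[of vs] by linarith
    have "{vs ! i, vs ! (Suc i mod length vs)} \<in> T" if "i < length vs" for i
    proof (cases "Suc i = length vs")
      case True
      then have "vs ! i = y" "vs ! (Suc i mod length vs) = x"
        using vs by (auto simp: hd_conv_nth last_conv_nth simp flip: True)
      then show ?thesis using xy by (simp add: insert_commute)
    next
      case False
      then show ?thesis using vs(5)[of i] that by auto
    qed
    then have "is_cycle T vs" using len vs by (auto simp: is_cycle_def)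
    then show False using cf by (auto simp: cycle_free_def)
  qed
next
  assume nd: "no_detour T"
  show "cycle_free T" unfolding cycle_free_def
  proof
    assume "\<exists>vs. is_cycle T vs"
    then obtain vs where len: "length vs \<ge> 3" and d: "distinct vs"
      and e: "\<And>i. i < length vs \<Longrightarrow> {vs ! i, vs ! (Suc i mod length vs)} \<in> T"
      by (auto simp: is_cycle_def)
    define k where "k = length vs - 1"
    have k: "Suc k = length vs" "k \<ge> 2" using len by (auto simp: k_def)
    let ?f = "{vs ! 0, vs ! k}"
    have "{vs ! i, vs ! Suc i} \<in> T - {?f}" if "i < k" for i
    proof -
      have "{vs ! i, vs ! Suc i} \<in> T" using e[of i] that k by auto
      moreover have "{vs ! i, vs ! Suc i} \<noteq> ?f"
      proof -
        have "i < length vs" "Suc i < length vs" "k < length vs" "0 < length vs"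
          using that k by auto
        then show ?thesis using that k by (auto simp: doubleton_eq_iff nth_eq_iff_index_eq[OF d])
      qed
      ultimately show ?thesis by auto
    qed
    then have "conn (T - {?f}) (vs ! 0) (vs ! k)" by (rule conn_along_list)
    moreover have "?f \<in> T" using e[of k] k by (simp add: insert_commute)
    ultimately show False using nd no_detourD by metis
  qed
qed

section \<open>Paths in trees as unit flows\<close>

text \<open>
  In a tree these are the edges of the path from \<open>a\<close> to \<open>b\<close>, oriented along the path: an edge
  belongs to the path exactly if its removal separates \<open>a\<close> from \<open>b\<close>.
\<close>

definition path_edges :: "'v set set \<Rightarrow> 'v \<Rightarrow> 'v \<Rightarrow> ('v \<times> 'v) set" where
  "path_edges T a b = {(x, y). {x, y} \<in> T \<and> conn (T - {{x, y}}) a x \<and> conn (T - {{x, y}}) b y}"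

lemma finite_ordered_edges:
  assumes "finite T" shows "finite {(x, y). {x, y} \<in> T}"
proof (rule finite_subset)
  show "{(x, y). {x, y} \<in> T} \<subseteq> (\<Union>e\<in>{e\<in>T. finite e}. e \<times> e)" by auto
qed (use assms in auto)

text \<open>
  Every edge other than \<open>{b, c}\<close> has \<open>b\<close> and \<open>c\<close> on the same side, so it separates \<open>a\<close>
  from \<open>c\<close> exactly if it separates \<open>a\<close> from \<open>b\<close>.
\<close>

lemma path_edges_step:
  assumes T: "no_detour T" and bc: "{b, c} \<in> T"
    and ab: "conn (T - {{b, c}}) a b"
  shows "path_edges T a c = insert (b, c) (path_edges T a b)" "(b, c) \<notin> path_edges T a b"
proof -
  have bcn: "\<not> conn (T - {{b, c}}) b c" using T bc no_detourD by metis
  have eq: "(x, y) \<in> path_edges T a c \<longleftrightarrow> (x, y) \<in> path_edges T a b" if "{x, y} \<noteq> {b, c}" for x y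
  proof -
    have "{b, c} \<in> T - {{x, y}}" using that bc by auto
    then have "conn (T - {{x, y}}) b y \<longleftrightarrow> conn (T - {{x, y}}) c y"
      by (meson conn_edge conn_sym conn_trans)
    then show ?thesis by (auto simp: path_edges_def)
  qed
  have 1: "(b, c) \<notin> path_edges T a b" using bcn by (auto simp: path_edges_def)
  have 2: "(c, b) \<notin> path_edges T a c" using bcn
    by (auto simp: path_edges_def insert_commute dest: conn_sym)
  have 3: "(c, b) \<notin> path_edges T a b" using bcn ab
    by (auto simp: path_edges_def insert_commute) (meson conn_sym conn_trans)
  have 4: "(b, c) \<in> path_edges T a c" using bc ab by (auto simp: path_edges_def)
  show "path_edges T a c = insert (b, c) (path_edges T a b)"
  proof (rule set_eqI, clarify)
    fix x y
    show "(x, y) \<in> path_edges T a c \<longleftrightarrow> (x, y) \<in> insert (b, c) (path_edges T a b)"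
    proof (cases "{x, y} = {b, c}")
      case True
      then have "(x = b \<and> y = c) \<or> (x = c \<and> y = b)" by (auto simp: doubleton_eq_iff)
      then show ?thesis using 1 2 3 4 by auto
    next
      case False
      then show ?thesis using eq[OF False] by auto
    qed
  qed
  show "(b, c) \<notin> path_edges T a b" by fact
qed

lemma finite_path_edges: "finite T \<Longrightarrow> finite (path_edges T a b)"
  by (rule finite_subset[OF _ finite_ordered_edges[of T]]) (auto simp: path_edges_def)

text \<open>
  The node law for the unit flow along a tree path, tested against an arbitrary function: the flow
  out of \<open>a\<close> into \<open>b\<close> pairs with the gradient of \<open>u\<close> to give \<open>u a - u b\<close>.
\<close>

lemma sum_path_edges:
  fixes u :: "'v \<Rightarrow> real"
  assumes T: "no_detour T" and fin: "finite T" and "conn T a b"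
  shows "(\<Sum>(x, y)\<in>path_edges T a b. u x - u y) = u a - u b"
  using assms(3)
proof (induction rule: conn_induct)
  case refl
  have "(x, y) \<notin> path_edges T a a" for x y
  proof
    assume "(x, y) \<in> path_edges T a a"
    then have "{x, y} \<in> T" "conn (T - {{x, y}}) a x" "conn (T - {{x, y}}) a y"
      by (auto simp: path_edges_def)
    then show False using no_detourD[OF T] by (meson conn_sym conn_trans)
  qed
  then have "path_edges T a a = {}" by auto
  then show ?case by simp
next
  case (step b c)
  let ?T = "T - {{b, c}}"
  \<comment> \<open>Either the path to \<open>c\<close> extends the path to \<open>b\<close>, or conversely.\<close>
  consider "conn ?T a b" | "conn ?T a c"
    using conn_remove_edge[OF step.hyps(1), of b c] by auto
  then show ?case
  proof cases
    case 1
    note P = path_edges_step[OF T step.hyps(2) 1]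
    show ?thesis unfolding P(1) using P(2) step.IH finite_path_edges[OF fin] by simp
  next
    case 2
    have cb: "{c, b} \<in> T" using step.hyps(2) by (simp add: insert_commute)
    note P = path_edges_step[OF T cb, of a]
    have 2: "conn (T - {{c, b}}) a c" using 2 by (simp add: insert_commute)
    show ?thesis using P(1)[OF 2] P(2)[OF 2] step.IH finite_path_edges[OF fin, of a c] by simp
  qed
qed

section \<open>Kirchhoff currents and Rayleigh monotonicity\<close>

definition spanning_trees :: "'v set \<Rightarrow> 'v set set \<Rightarrow> 'v set set \<Rightarrow> 'v set set set" where
  "spanning_trees V E A =
     {T. A \<subseteq> T \<and> T \<subseteq> E \<and> no_detour T \<and> (\<forall>x\<in>V. \<forall>y\<in>V. conn T x y)}"

definition two_forests :: "'v set \<Rightarrow> 'v set set \<Rightarrow> 'v set set \<Rightarrow> 'v \<Rightarrow> 'v \<Rightarrow> 'v set set set" where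
  "two_forests V E A a b =
     {F. A \<subseteq> F \<and> F \<subseteq> E \<and> no_detour F \<and> \<not> conn F a b \<and> (\<forall>x\<in>V. conn F a x \<or> conn F b x)}"

definition num_trees :: "'v set \<Rightarrow> 'v set set \<Rightarrow> 'v set set \<Rightarrow> real" where
  "num_trees V E A = real (card (spanning_trees V E A))"

text \<open>
  Up to the factor \<open>num_trees V E A\<close>, this is the electric potential of a unit current from \<open>a\<close>
  to \<open>b\<close> in the network where all edges have resistance 1, except that the edges of \<open>A\<close> are
  contracted.
\<close>

definition potential :: "'v set \<Rightarrow> 'v set set \<Rightarrow> 'v set set \<Rightarrow> 'v \<Rightarrow> 'v \<Rightarrow> 'v \<Rightarrow> real" where
  "potential V E A a b x = real (card {F \<in> two_forests V E A a b. conn F a x})"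

locale finite_graph =
  fixes V :: "'v set" and E :: "'v set set"
  assumes finite_V: "finite V" and edges: "\<And>e. e \<in> E \<Longrightarrow> \<exists>x\<in>V. \<exists>y\<in>V. x \<noteq> y \<and> e = {x, y}"
begin

lemma edge_in_V: "{x, y} \<in> E \<Longrightarrow> x \<in> V \<and> y \<in> V"
  using edges[of "{x, y}"] by (auto simp: doubleton_eq_iff)

lemma finite_E: "finite E"
proof (rule finite_subset)
  show "E \<subseteq> Pow V" using edges by fastforce
qed (use finite_V in auto)

lemma finite_trees: "finite (spanning_trees V E A)"
  by (rule finite_subset[of _ "Pow E"]) (use finite_E in \<open>auto simp: spanning_trees_def\<close>)

lemma finite_two_forests: "finite (two_forests V E A a b)"
  by (rule finite_subset[of _ "Pow E"]) (use finite_E in \<open>auto simp: two_forests_def\<close>)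

text \<open>
  Joining the two components of a forest by \<open>{x, y}\<close> gives a tree whose path from \<open>a\<close> to
  \<open>b\<close> runs through \<open>(x, y)\<close>, and deleting the edge undoes this. The edge must not lie in
  \<open>A\<close>, since the deletion would destroy the condition that the forest contains \<open>A\<close>.
\<close>

lemma card_separating_forests:
  assumes xy: "{x, y} \<in> E" "{x, y} \<notin> A" and ab: "a \<in> V" "b \<in> V"
  shows "card {F \<in> two_forests V E A a b. conn F a x \<and> conn F b y}
    = card {T \<in> spanning_trees V E A. (x, y) \<in> path_edges T a b}"
proof (rule bij_betw_same_card, rule bij_betwI)
  let ?L = "{F \<in> two_forests V E A a b. conn F a x \<and> conn F b y}"
  let ?R = "{T \<in> spanning_trees V E A. (x, y) \<in> path_edges T a b}"
  let ?e = "{x, y}"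
  have nin: "?e \<notin> F" if "F \<in> ?L" for F
    using that by (auto simp: two_forests_def dest!: conn_edge) (meson conn_sym conn_trans)
  show "insert ?e \<in> ?L \<rightarrow> ?R"
  proof
    fix F assume F: "F \<in> ?L"
    then have F': "A \<subseteq> F" "F \<subseteq> E" "no_detour F" "\<not> conn F a b" "conn F a x" "conn F b y"
      "\<And>z. z \<in> V \<Longrightarrow> conn F a z \<or> conn F b z" by (auto simp: two_forests_def)
    have nxy: "\<not> conn F x y" using F' by (meson conn_sym conn_trans)
    let ?T = "insert ?e F"
    have [simp]: "?T - {?e} = F" using nin[OF F] by auto
    have up: "conn F p q \<Longrightarrow> conn ?T p q" for p q by (erule conn_mono) auto
    have "conn ?T a b" using up[OF F'(5)] up[OF F'(6)] conn_edge[of x y ?T]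
      by (meson conn_sym conn_trans insertI1)
    then have "conn ?T a z" if "z \<in> V" for z using F'(7)[OF that] up by (meson conn_trans)
    then have "conn ?T p q" if "p \<in> V" "q \<in> V" for p q using that by (meson conn_sym conn_trans)
    then show "?T \<in> ?R" using F' xy no_detour_insert[OF F'(3) nxy]
      by (auto simp: spanning_trees_def path_edges_def)
  qed
  show "(\<lambda>T. T - {?e}) \<in> ?R \<rightarrow> ?L"
  proof
    fix T assume "T \<in> ?R"
    then have T: "A \<subseteq> T" "T \<subseteq> E" "no_detour T" "\<And>p q. p \<in> V \<Longrightarrow> q \<in> V \<Longrightarrow> conn T p q"
      "?e \<in> T" "conn (T - {?e}) a x" "conn (T - {?e}) b y"
      by (auto simp: spanning_trees_def path_edges_def)
    have "\<not> conn (T - {?e}) a b" using T no_detourD[OF T(3,5)] by (meson conn_sym conn_trans)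
    moreover have "conn (T - {?e}) a z \<or> conn (T - {?e}) b z" if "z \<in> V" for z
      using conn_remove_edge[OF T(4)[OF ab(1) that], of x y] T(6,7) by (meson conn_trans)
    ultimately show "T - {?e} \<in> ?L" using T xy no_detour_subset[OF T(3), of "T - {?e}"]
      by (auto simp: two_forests_def)
  qed
  show "insert ?e F - {?e} = F" if "F \<in> ?L" for F using nin[OF that] by auto
  show "insert ?e (T - {?e}) = T" if "T \<in> ?R" for T using that by (auto simp: path_edges_def)
qed

text \<open>
  Ohm's law in combinatorial form: forests with \<open>x\<close> and \<open>y\<close> in the same component cancel, and by
  \<open>card_separating_forests\<close> the remaining counts are those of the trees whose path traverses the
  edge in one or in the other direction.
\<close>

lemma potential_diff:
  assumes xy: "x \<in> V" "y \<in> V"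
  shows "potential V E A a b x - potential V E A a b y
    = real (card {F \<in> two_forests V E A a b. conn F a x \<and> conn F b y})
    - real (card {F \<in> two_forests V E A a b. conn F a y \<and> conn F b x})"
proof -
  let ?K = "two_forests V E A a b"
  note fin = finite_two_forests[of A a b]
  have split: "potential V E A a b x = real (card {F \<in> ?K. conn F a x \<and> conn F a y})
      + real (card {F \<in> ?K. conn F a x \<and> conn F b y})" if "x \<in> V" "y \<in> V" for x y
  proof -
    have eq: "{F \<in> ?K. conn F a x}
        = {F \<in> ?K. conn F a x \<and> conn F a y} \<union> {F \<in> ?K. conn F a x \<and> conn F b y}"
      using that by (auto simp: two_forests_def)
    have dis: "{F \<in> ?K. conn F a x \<and> conn F a y} \<inter> {F \<in> ?K. conn F a x \<and> conn F b y} = {}"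
      by (auto simp: two_forests_def) (meson conn_sym conn_trans)
    show ?thesis unfolding potential_def eq
      by (subst card_Un_disjoint) (use fin dis in auto)
  qed
  have "{F \<in> ?K. conn F a x \<and> conn F a y} = {F \<in> ?K. conn F a y \<and> conn F a x}" by auto
  then show ?thesis using split[OF xy] split[OF xy(2,1)] by simp
qed

definition free_pairs :: "'v set set \<Rightarrow> ('v \<times> 'v) set" where
  "free_pairs A = {(x, y). {x, y} \<in> E - A}"

lemma finite_free_pairs: "finite (free_pairs A)"
  unfolding free_pairs_def by (rule finite_ordered_edges) (use finite_E in auto)

text \<open>
  The gradient of the potential is the sum over all spanning trees of the path flows, except on the
  edges of \<open>A\<close>, where it vanishes but the flows do not. Since \<open>u\<close> is constant along those
  edges, they do not contribute, and \<open>sum_path_edges\<close> applies to each tree. The factor 2 arises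
  because every edge occurs in both orientations.
\<close>

lemma sum_potential:
  fixes u :: "'v \<Rightarrow> real"
  assumes AE: "A \<subseteq> E" and ab: "a \<in> V" "b \<in> V"
    and u: "\<And>x y. {x, y} \<in> A \<Longrightarrow> u x = u y"
  shows "(\<Sum>(x, y)\<in>free_pairs A.
      (potential V E A a b x - potential V E A a b y) * (u x - u y))
    = 2 * num_trees V E A * (u a - u b)"
proof -
  let ?D = "free_pairs A" and ?S = "spanning_trees V E A"
  define M where "M = (\<lambda>x y. real (card {T \<in> ?S. (x, y) \<in> path_edges T a b}))"
  note finD = finite_free_pairs[of A] and finS = finite_trees[of A]
  have diff: "potential V E A a b x - potential V E A a b y = M x y - M y x"
    if "(x, y) \<in> ?D" for x y
  proof -
    have e: "{x, y} \<in> E" "{x, y} \<notin> A" "{y, x} \<in> E" "{y, x} \<notin> A"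
      using that by (auto simp: free_pairs_def insert_commute)
    show ?thesis
      using potential_diff[of x y A a b] edge_in_V[OF e(1)]
        card_separating_forests[OF e(1,2) ab] card_separating_forests[OF e(3,4) ab]
      by (simp add: M_def)
  qed
  have swap: "(\<Sum>(x, y)\<in>?D. M y x * (u x - u y)) = (\<Sum>(x, y)\<in>?D. M x y * (u y - u x))"
    by (rule sum.reindex_bij_witness[where i = prod.swap and j = prod.swap])
      (auto simp: free_pairs_def insert_commute)
  have "(\<Sum>(x, y)\<in>?D. (potential V E A a b x - potential V E A a b y) * (u x - u y))
      = (\<Sum>(x, y)\<in>?D. M x y * (u x - u y) - M y x * (u x - u y))"
    by (rule sum.cong) (auto simp: diff simp flip: left_diff_distrib)
  also have "\<dots> = (\<Sum>(x, y)\<in>?D. M x y * (u x - u y)) - (\<Sum>(x, y)\<in>?D. M y x * (u x - u y))"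
    by (simp add: case_prod_unfold sum_subtractf)
  also have "\<dots> = 2 * (\<Sum>(x, y)\<in>?D. M x y * (u x - u y))"
    unfolding swap by (simp add: case_prod_unfold algebra_simps sum_subtractf)
  also have "(\<Sum>(x, y)\<in>?D. M x y * (u x - u y))
      = (\<Sum>(x, y)\<in>?D. \<Sum>T\<in>?S. if (x, y) \<in> path_edges T a b then u x - u y else 0)"
  proof (rule sum.cong[OF refl], clarify)
    fix x y
    have "(\<Sum>T\<in>?S. if (x, y) \<in> path_edges T a b then u x - u y else 0)
        = (\<Sum>T\<in>{T\<in>?S. (x, y) \<in> path_edges T a b}. u x - u y)"
      by (simp add: sum.If_cases finS Int_def)
    then show "M x y * (u x - u y)
        = (\<Sum>T\<in>?S. if (x, y) \<in> path_edges T a b then u x - u y else 0)"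
      by (simp add: M_def)
  qed
  also have "\<dots> = (\<Sum>T\<in>?S. \<Sum>(x, y)\<in>?D. if (x, y) \<in> path_edges T a b then u x - u y else 0)"
    by (simp only: case_prod_unfold) (rule sum.swap)
  also have "\<dots> = (\<Sum>T\<in>?S. u a - u b)"
  proof (rule sum.cong[OF refl])
    fix T assume "T \<in> ?S"
    then have T: "A \<subseteq> T" "T \<subseteq> E" "no_detour T" "conn T a b"
      using ab by (auto simp: spanning_trees_def)
    have finT: "finite T" using T(2) finite_E by (rule finite_subset)
    have "(\<Sum>(x, y)\<in>?D. if (x, y) \<in> path_edges T a b then u x - u y else 0)
        = (\<Sum>(x, y)\<in>?D \<inter> path_edges T a b. u x - u y)"
      unfolding case_prod_unfold by (subst sum.inter_restrict[OF finD]) simp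
    also have "\<dots> = (\<Sum>(x, y)\<in>path_edges T a b. u x - u y)"
    proof (rule sum.mono_neutral_left[OF finite_path_edges[OF finT]])
      show "\<forall>p\<in>path_edges T a b - ?D \<inter> path_edges T a b. (case p of (x, y) \<Rightarrow> u x - u y) = 0"
        using u T(2) by (fastforce simp: path_edges_def free_pairs_def)
    qed auto
    finally show "(\<Sum>(x, y)\<in>?D. if (x, y) \<in> path_edges T a b then u x - u y else 0) = u a - u b"
      using sum_path_edges[OF T(3) finT T(4)] by simp
  qed
  finally show ?thesis by (simp add: num_trees_def)
qed

lemma potential_const_on_A:
  assumes "{x, y} \<in> A"
  shows "potential V E A a b x = potential V E A a b y"
proof -
  have "{F \<in> two_forests V E A a b. conn F a x} = {F \<in> two_forests V E A a b. conn F a y}"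
    using assms by (auto simp: two_forests_def)
      (metis conn_edge conn_sym conn_trans subsetD)+
  then show ?thesis by (simp add: potential_def)
qed

text \<open>
  All spanning forests with two components contribute to the potential at \<open>a\<close> and none at \<open>b\<close>;
  adding the edge turns them into the trees through that edge.
\<close>

lemma potential_drop:
  assumes ab: "{a, b} \<in> E" "{a, b} \<notin> A"
  shows "potential V E A a b a - potential V E A a b b = num_trees V E (insert {a, b} A)"
proof -
  have V: "a \<in> V" "b \<in> V" using edge_in_V[OF ab(1)] by auto
  have "card {F \<in> two_forests V E A a b. conn F a b \<and> conn F b a} = 0"
    by (auto simp: two_forests_def card_eq_0_iff)
  moreover have "{T \<in> spanning_trees V E A. (a, b) \<in> path_edges T a b}
      = spanning_trees V E (insert {a, b} A)"
    by (auto simp: spanning_trees_def path_edges_def)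
  ultimately show ?thesis
    using potential_diff[OF V, of A a b] card_separating_forests[OF ab V]
    by (simp add: num_trees_def)
qed

end

lemma num_trees_nonneg [simp]: "num_trees V E A \<ge> 0"
  by (simp add: num_trees_def)

text \<open>
  Let \<open>p\<close> and \<open>q\<close> be the potentials of the small and the large graph. By \<open>sum_potential\<close>, the
  energy of \<open>p\<close> on the small graph and the energy of \<open>q\<close> on the large graph are both products of
  tree counts, and so is the mixed energy on the small graph, since \<open>q\<close> is an admissible test
  function there. Cauchy-Schwarz on the small graph, followed by extending the energy of \<open>q\<close> to the
  large graph, gives the claim.
\<close>

lemma num_trees_insert_mono:
  assumes G: "finite_graph V E" and G': "finite_graph V' E'" and sub: "V \<subseteq> V'" "E \<subseteq> E'"
    and A: "A \<subseteq> E" and e: "e \<in> E" "e \<notin> A"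
  shows "num_trees V E A * num_trees V' E' (insert e A)
    \<le> num_trees V E (insert e A) * num_trees V' E' A"
proof -
  interpret G: finite_graph V E by fact
  interpret G': finite_graph V' E' by fact
  obtain a b where ab: "e = {a, b}" "a \<in> V" "b \<in> V" using G.edges[OF e(1)] by auto
  let ?p = "potential V E A a b" and ?q = "potential V' E' A a b"
  let ?N = "num_trees V E A" and ?N' = "num_trees V' E' A"
  let ?M = "num_trees V E (insert e A)" and ?M' = "num_trees V' E' (insert e A)"
  let ?D = "G.free_pairs A" and ?D' = "G'.free_pairs A"
  have e': "e \<in> E'" using e sub by auto
  have dp: "?p a - ?p b = ?M" using G.potential_drop[of a b A] e ab by simp
  have dq: "?q a - ?q b = ?M'" using G'.potential_drop[of a b A] e e' ab by simp
  have Ep: "(\<Sum>z\<in>?D. (?p (fst z) - ?p (snd z))\<^sup>2) = 2 * ?N * ?M"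
    using G.sum_potential[OF A ab(2,3), of ?p] dp G.potential_const_on_A[of _ _ A a b]
    by (simp add: case_prod_unfold power2_eq_square)
  have Eq: "(\<Sum>z\<in>?D'. (?q (fst z) - ?q (snd z))\<^sup>2) = 2 * ?N' * ?M'"
    using G'.sum_potential[of A a b ?q] A ab(2,3) sub dq G'.potential_const_on_A[of _ _ A a b]
    by (auto simp: case_prod_unfold power2_eq_square)
  have "(\<Sum>z\<in>?D. (?p (fst z) - ?p (snd z)) * (?q (fst z) - ?q (snd z))) = 2 * ?N * ?M'"
    using G.sum_potential[OF A ab(2,3), of ?q] dq G'.potential_const_on_A[of _ _ A a b]
    by (auto simp: case_prod_unfold)
  then have "(2 * ?N * ?M')\<^sup>2 \<le> (2 * ?N * ?M) * (\<Sum>z\<in>?D. (?q (fst z) - ?q (snd z))\<^sup>2)"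
    using Cauchy_Schwarz_ineq_sum[of "\<lambda>z. ?p (fst z) - ?p (snd z)"
        "\<lambda>z. ?q (fst z) - ?q (snd z)" ?D] Ep by simp
  also have "\<dots> \<le> (2 * ?N * ?M) * (2 * ?N' * ?M')"
    unfolding Eq[symmetric]
    by (intro mult_left_mono sum_mono2 G'.finite_free_pairs)
      (use sub in \<open>auto simp: G.free_pairs_def G'.free_pairs_def\<close>)
  finally have *: "(?N * ?M') * (?N * ?M') \<le> (?M * ?N') * (?N * ?M')"
    by (simp add: power2_eq_square algebra_simps)
  show ?thesis
  proof (cases "?N * ?M' = 0")
    case True
    then show ?thesis using num_trees_nonneg by (metis mult_nonneg_nonneg)
  next
    case False
    then have "?N * ?M' > 0" using num_trees_nonneg[of V E A] num_trees_nonneg[of V' E' "insert e A"]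
      by (metis less_eq_real_def mult_nonneg_nonneg)
    then show ?thesis using * by (simp add: mult_le_cancel_right)
  qed
qed

text \<open>
  After division by the total numbers of trees, this says that the probability that a uniform
  spanning tree contains \<open>A\<close> decreases when the graph grows. It follows by telescoping
  \<open>num_trees_insert_mono\<close> over the edges of \<open>A\<close>.
\<close>

lemma num_trees_mono:
  assumes G: "finite_graph V E" and G': "finite_graph V' E'" and sub: "V \<subseteq> V'" "E \<subseteq> E'"
    and A: "A \<subseteq> E"
  shows "num_trees V' E' A * num_trees V E {} \<le> num_trees V E A * num_trees V' E' {}"
proof -
  have "finite A" using finite_graph.finite_E[OF G] A by (rule finite_subset[rotated])
  then show ?thesis using A
  proof (induction A rule: finite_induct)
    case (insert e A)
    let ?N = "num_trees V E" and ?N' = "num_trees V' E'"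
    have IH: "?N' A * ?N {} \<le> ?N A * ?N' {}" using insert by auto
    have step: "?N A * ?N' (insert e A) \<le> ?N (insert e A) * ?N' A"
      using num_trees_insert_mono[OF G G' sub, of A e] insert by auto
    have le: "?N' (insert e A) \<le> ?N' A" unfolding num_trees_def
      by (intro of_nat_mono card_mono finite_graph.finite_trees[OF G'])
        (auto simp: spanning_trees_def)
    show ?case
    proof (cases "?N' A = 0")
      case True
      then have "?N' (insert e A) = 0" using le num_trees_nonneg[of V' E' "insert e A"] by linarith
      then show ?thesis by simp
    next
      case False
      then have pos: "?N' A > 0" using num_trees_nonneg[of V' E' A] by linarith
      have "(?N' (insert e A) * ?N {}) * ?N' A = ?N' (insert e A) * (?N' A * ?N {})" by simp
      also have "\<dots> \<le> ?N' (insert e A) * (?N A * ?N' {})" by (intro mult_left_mono IH) simp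
      also have "\<dots> = (?N A * ?N' (insert e A)) * ?N' {}" by simp
      also have "\<dots> \<le> (?N (insert e A) * ?N' A) * ?N' {}" by (intro mult_right_mono step) simp
      finally have "(?N' (insert e A) * ?N {}) * ?N' A \<le> (?N (insert e A) * ?N' {}) * ?N' A"
        by (simp add: algebra_simps)
      then show ?thesis using pos by (simp add: mult_le_cancel_right)
    qed
  qed simp
qed

text \<open>
  A maximal acyclic subgraph spans, as any edge between two of its components could be added.
\<close>

lemma (in finite_graph) spanning_tree_exists:
  assumes "\<And>x y. x \<in> V \<Longrightarrow> y \<in> V \<Longrightarrow> conn E x y"
  shows "num_trees V E {} > 0"
proof -
  let ?F = "{T. T \<subseteq> E \<and> no_detour T}"
  have "finite ?F" by (rule finite_subset[of _ "Pow E"]) (use finite_E in auto)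
  moreover have "{} \<in> ?F" by (auto simp: no_detour_def)
  ultimately have "\<exists>T\<in>?F. \<forall>S\<in>?F. T \<subseteq> S \<longrightarrow> T = S"
    by (intro finite_has_maximal) auto
  then obtain T where T: "T \<subseteq> E" "no_detour T"
    and max: "\<And>S. S \<subseteq> E \<Longrightarrow> no_detour S \<Longrightarrow> T \<subseteq> S \<Longrightarrow> T = S"
    by auto
  have edge: "conn T x y" if "{x, y} \<in> E" for x y
  proof (rule ccontr)
    assume n: "\<not> conn T x y"
    then have "T = insert {x, y} T"
      using max[of "insert {x, y} T"] no_detour_insert[OF T(2) n] T(1) that by auto
    then show False using n conn_edge by (metis insertI1)
  qed
  have "conn T x y" if "conn E x y" for x y
    using that by (induction rule: conn_induct) (auto intro: conn_trans edge)
  then have "T \<in> spanning_trees V E {}" using assms T by (auto simp: spanning_trees_def)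
  then show ?thesis unfolding num_trees_def using finite_trees
    by (auto simp: card_gt_0_iff)
qed

section \<open>Transport along bijections of the vertices\<close>

abbreviation edge_map :: "('v \<Rightarrow> 'w) \<Rightarrow> 'v set set \<Rightarrow> 'w set set" where
  "edge_map f T \<equiv> (`) f ` T"

lemma conn_edge_map:
  assumes "conn T x y" shows "conn (edge_map f T) (f x) (f y)"
  using assms
proof (induction rule: conn_induct)
  case (step y z)
  have "{f y, f z} = f ` {y, z}" by simp
  then have "{f y, f z} \<in> edge_map f T" using step.hyps(2) by blast
  then show ?case using step.IH conn_step by metis
qed simp

lemma edge_map_inv: "bij f \<Longrightarrow> edge_map (inv f) (edge_map f T) = T"
  by (simp add: image_image bij_is_inj)

lemma conn_edge_map_iff:
  assumes "bij f" shows "conn (edge_map f T) (f x) (f y) \<longleftrightarrow> conn T x y"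
  using conn_edge_map[of T x y f] conn_edge_map[of "edge_map f T" "f x" "f y" "inv f"] assms
    edge_map_inv[OF assms, of T]
  by (auto simp: bij_is_inj)

lemma inj_image_set: "bij f \<Longrightarrow> inj ((`) f)"
  by (rule injI) (simp add: inj_image_eq_iff bij_is_inj)

lemma edge_map_mem:
  assumes "bij f" shows "f ` e \<in> edge_map f T \<longleftrightarrow> e \<in> T"
  by (rule inj_image_mem_iff[OF inj_image_set[OF assms]])

lemma edge_map_mem_pair:
  assumes "bij f" shows "{f x, f y} \<in> edge_map f T \<longleftrightarrow> {x, y} \<in> T"
  using edge_map_mem[OF assms, of "{x, y}"] by simp

lemma edge_map_Diff:
  assumes "bij f" shows "edge_map f T - {{f x, f y}} = edge_map f (T - {{x, y}})"
proof -
  have "edge_map f (T - {{x, y}}) = edge_map f T - edge_map f {{x, y}}"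
    by (rule image_set_diff[OF inj_image_set[OF assms]])
  then show ?thesis by simp
qed

lemma no_detour_edge_map:
  assumes f: "bij f" and T: "no_detour T" shows "no_detour (edge_map f T)"
  unfolding no_detour_def
proof (intro allI impI)
  fix p q assume pq: "{p, q} \<in> edge_map f T"
  obtain x y where [simp]: "p = f x" "q = f y" using f by (meson bij_pointE)
  show "\<not> conn (edge_map f T - {{p, q}}) p q"
    using T pq f by (auto simp: edge_map_Diff edge_map_mem_pair conn_edge_map_iff no_detour_def)
qed

lemma spanning_trees_edge_map:
  assumes f: "bij f" and T: "T \<in> spanning_trees V E A"
  shows "edge_map f T \<in> spanning_trees (f ` V) (edge_map f E) (edge_map f A)"
  using T no_detour_edge_map[OF f] conn_edge_map_iff[OF f] by (auto simp: spanning_trees_def)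

lemma num_trees_edge_map:
  assumes f: "bij f"
  shows "num_trees (f ` V) (edge_map f E) (edge_map f A) = num_trees V E A"
proof -
  have g: "bij (inv f)" using f by (rule bij_imp_bij_inv)
  have fi: "edge_map f (edge_map (inv f) T) = T" for T
    using edge_map_inv[OF g, of T] f by (simp add: inv_inv_eq)
  have "bij_betw (edge_map f) (spanning_trees V E A)
      (spanning_trees (f ` V) (edge_map f E) (edge_map f A))"
  proof (rule bij_betwI[where g = "edge_map (inv f)"])
    show "edge_map f \<in> spanning_trees V E A
        \<rightarrow> spanning_trees (f ` V) (edge_map f E) (edge_map f A)"
      using spanning_trees_edge_map[OF f] by auto
    show "edge_map (inv f) \<in> spanning_trees (f ` V) (edge_map f E) (edge_map f A)
        \<rightarrow> spanning_trees V E A"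
      using spanning_trees_edge_map[OF g, of _ "f ` V" "edge_map f E" "edge_map f A"]
      by (auto simp: edge_map_inv[OF f] image_image bij_is_inj[OF f])
  qed (use edge_map_inv[OF f] fi in auto)
  then show ?thesis by (simp add: num_trees_def bij_betw_same_card)
qed

section \<open>Boxes in the lattice\<close>

lemma lattice_edgesE:
  assumes "e \<in> lattice_edges"
  obtains x y where "e = {x, y}" "x \<noteq> y" "(\<Sum>i\<in>UNIV. \<bar>x $ i - y $ i\<bar>) = 1"
  using assms by (fastforce simp: lattice_edges_def)

lemma lattice_edge_iff: "{x, y} \<in> lattice_edges \<longleftrightarrow> (\<Sum>i\<in>UNIV. \<bar>x $ i - y $ i\<bar>) = 1"
  by (auto simp: lattice_edges_def doubleton_eq_iff abs_minus_commute)

lemma simple_edges_lattice: "T \<subseteq> lattice_edges \<Longrightarrow> simple_edges T"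
  unfolding simple_edges_def by (meson lattice_edgesE subsetD)

lemma lattice_adj_le:
  fixes x y :: "int ^ 'd::finite"
  assumes "{x, y} \<in> lattice_edges" shows "\<bar>x $ i - y $ i\<bar> \<le> 1"
proof -
  have "\<bar>x $ i - y $ i\<bar> \<le> (\<Sum>i\<in>UNIV. \<bar>x $ i - y $ i\<bar>)" by (rule member_le_sum) auto
  then show ?thesis using assms by (simp add: lattice_edge_iff)
qed

definition translate :: "int ^ 'd::finite \<Rightarrow> int ^ 'd \<Rightarrow> int ^ 'd" where
  "translate x = (\<lambda>v. v + x)"

lemma bij_translate: "bij (translate x)"
  unfolding translate_def by (rule bij_betw_byWitness[where f' = "\<lambda>v. v - x"]) auto

lemma translate_inverse [simp]: "translate (- x) (translate x v) = v" "translate x (translate (- x) v) = v"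
  by (auto simp: translate_def)

lemma translate_image_lattice: "translate x ` e \<in> lattice_edges \<longleftrightarrow> e \<in> lattice_edges"
proof -
  have *: "translate x ` e \<in> lattice_edges" if "e \<in> lattice_edges" for x e
    using that by (rule lattice_edgesE) (simp add: lattice_edge_iff translate_def)
  show ?thesis using *[of e x] *[of "translate x ` e" "- x"] by (auto simp: image_image)
qed

definition induced_edges :: "(int ^ 'd::finite) set \<Rightarrow> (int ^ 'd) set set" where
  "induced_edges V = {e \<in> lattice_edges. e \<subseteq> V}"

lemma finite_graph_induced: "finite V \<Longrightarrow> finite_graph V (induced_edges V)"
proof
  fix e assume "e \<in> induced_edges V"
  then have "e \<in> lattice_edges" "e \<subseteq> V" by (auto simp: induced_edges_def)
  then show "\<exists>x\<in>V. \<exists>y\<in>V. x \<noteq> y \<and> e = {x, y}" by (elim lattice_edgesE) auto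
qed auto

lemma box_edges_eq: "box_edges n = induced_edges (box_vertices n)"
  by (simp add: box_edges_def induced_edges_def)

lemma finite_box: "finite (box_vertices n)"
proof -
  have "box_vertices n \<subseteq> vec_lambda ` (PiE UNIV (\<lambda>_. {- int n..int n}))"
  proof
    fix x assume "x \<in> box_vertices n"
    then have "vec_nth x \<in> PiE UNIV (\<lambda>_. {- int n..int n})"
      by (auto simp: box_vertices_def abs_le_iff) (metis minus_le_iff)
    then show "x \<in> vec_lambda ` (PiE UNIV (\<lambda>_. {- int n..int n}))"
      by (metis imageI vec_nth_inverse)
  qed
  then show ?thesis by (rule finite_subset) (intro finite_imageI finite_PiE, auto)
qed

lemma box_mono: "m \<le> n \<Longrightarrow> box_vertices m \<subseteq> box_vertices n"
proof -
  assume "m \<le> n"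
  then have "int m \<le> int n" by simp
  then show ?thesis unfolding box_vertices_def by (auto intro: order_trans)
qed

lemma finite_subset_box:
  assumes "finite S" shows "\<exists>n. S \<subseteq> box_vertices n"
  using assms
proof (induction rule: finite_induct)
  case (insert x S)
  then obtain n where n: "S \<subseteq> box_vertices n" by auto
  let ?k = "nat (\<Sum>i\<in>UNIV. \<bar>x $ i\<bar>)"
  have "\<bar>x $ i\<bar> \<le> int ?k" for i
    using member_le_sum[of i UNIV "\<lambda>i. \<bar>x $ i\<bar>"] by (simp add: sum_nonneg)
  then have "x \<in> box_vertices ?k" by (simp add: box_vertices_def)
  then have "insert x S \<subseteq> box_vertices (max n ?k)"
    using n box_mono[of n "max n ?k"] box_mono[of ?k "max n ?k"] by auto
  then show ?case by blast
qed simp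

text \<open>
  Moving one coordinate towards zero stays in the box and decreases the distance to the origin.
\<close>

lemma box_connected_origin:
  fixes x :: "int ^ 'd::finite"
  assumes "x \<in> box_vertices n" shows "conn (box_edges n) x 0"
  using assms
proof (induction "nat (\<Sum>i\<in>UNIV. \<bar>x $ i\<bar>)" arbitrary: x rule: less_induct)
  case (less x)
  show ?case
  proof (cases "x = 0")
    case False
    then obtain i where i: "x $ i \<noteq> 0" by (auto simp: vec_eq_iff)
    define y where "y = (\<chi> j. if j = i then x $ i - sgn (x $ i) else x $ j)"
    have y: "\<bar>y $ j\<bar> = \<bar>x $ j\<bar> - (if j = i then 1 else 0)"
      "\<bar>x $ j - y $ j\<bar> = (if j = i then 1 else 0)" for j
      using i by (auto simp: y_def sgn_if)
    have e: "{x, y} \<in> lattice_edges" by (simp add: lattice_edge_iff y(2))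
    have "\<bar>y $ j\<bar> \<le> int n" for j
      using less.prems by (simp add: y(1) box_vertices_def) (smt (verit))
    then have yb: "y \<in> box_vertices n" by (simp add: box_vertices_def)
    have "(\<Sum>j\<in>UNIV. \<bar>y $ j\<bar>) = (\<Sum>j\<in>UNIV. \<bar>x $ j\<bar>) - 1"
      by (simp add: y(1) sum_subtractf)
    moreover have "(\<Sum>j\<in>UNIV. \<bar>y $ j\<bar>) \<ge> 0" by (simp add: sum_nonneg)
    ultimately have "nat (\<Sum>j\<in>UNIV. \<bar>y $ j\<bar>) < nat (\<Sum>j\<in>UNIV. \<bar>x $ j\<bar>)" by linarith
    then have "conn (box_edges n) y 0" using less.hyps yb by blast
    moreover have "{x, y} \<in> box_edges n" using e yb less.prems by (simp add: box_edges_def)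
    ultimately show ?thesis using conn_edge conn_trans by metis
  qed simp
qed

lemma box_connected:
  "x \<in> box_vertices n \<Longrightarrow> y \<in> box_vertices n \<Longrightarrow> conn (box_edges n) x y"
  by (meson box_connected_origin conn_sym conn_trans)

lemma box_spanning_trees_eq: "box_spanning_trees n = spanning_trees (box_vertices n) (box_edges n) {}"
proof -
  have "cycle_free T \<longleftrightarrow> no_detour T" if "T \<subseteq> box_edges n" for T :: "(int ^ 'd) set set"
    by (rule cycle_free_iff_no_detour[OF simple_edges_lattice]) (use that in \<open>auto simp: box_edges_def\<close>)
  then show ?thesis by (auto simp: box_spanning_trees_def spanning_trees_def conn_def)
qed

definition inclusion_prob :: "(int ^ 'd::finite) set \<Rightarrow> (int ^ 'd) set set \<Rightarrow> real" where
  "inclusion_prob V F = num_trees V (induced_edges V) F / num_trees V (induced_edges V) {}"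

lemma num_trees_box_pos: "num_trees (box_vertices n) (induced_edges (box_vertices n)) {} > 0"
  by (rule finite_graph.spanning_tree_exists[OF finite_graph_induced[OF finite_box]])
    (rule box_connected[unfolded box_edges_eq])

text \<open>
  The tree counts of disconnected graphs vanish and make the quotient 0, so both graphs must have a
  spanning tree.
\<close>

lemma inclusion_prob_antimono:
  assumes "finite V'" "V \<subseteq> V'" "F \<subseteq> induced_edges V"
    and "num_trees V (induced_edges V) {} > 0" "num_trees V' (induced_edges V') {} > 0"
  shows "inclusion_prob V' F \<le> inclusion_prob V F"
proof -
  have "finite V" using assms(1,2) by (rule finite_subset[rotated])
  then have "num_trees V' (induced_edges V') F * num_trees V (induced_edges V) {}
      \<le> num_trees V (induced_edges V) F * num_trees V' (induced_edges V') {}"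
    using assms(1-3) by (intro num_trees_mono finite_graph_induced) (auto simp: induced_edges_def)
  then show ?thesis using assms(4,5) unfolding inclusion_prob_def
    by (simp add: pos_divide_le_eq pos_le_divide_eq)
qed

lemma induced_edges_translate: "induced_edges (translate x ` V) = edge_map (translate x) (induced_edges V)"
proof
  show "induced_edges (translate x ` V) \<subseteq> edge_map (translate x) (induced_edges V)"
  proof
    fix e assume e: "e \<in> induced_edges (translate x ` V)"
    then have "translate (- x) ` e \<in> induced_edges V"
      by (auto simp: induced_edges_def translate_image_lattice)
    moreover have "e = translate x ` translate (- x) ` e" by (simp add: image_image)
    ultimately show "e \<in> edge_map (translate x) (induced_edges V)" by blast
  qed
qed (auto simp: induced_edges_def translate_image_lattice)

lemma num_trees_translate:
  "num_trees (translate x ` V) (induced_edges (translate x ` V)) (edge_map (translate x) F)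
    = num_trees V (induced_edges V) F"
  unfolding induced_edges_translate by (rule num_trees_edge_map[OF bij_translate])

lemma inclusion_prob_translate:
  "inclusion_prob (translate x ` V) (edge_map (translate x) F) = inclusion_prob V F"
  using num_trees_translate[of x V F] num_trees_translate[of x V "{}"] by (simp add: inclusion_prob_def)

lemma finite_edges_subset_box:
  assumes "finite F" "F \<subseteq> lattice_edges" shows "\<exists>n. F \<subseteq> box_edges n"
proof -
  have "finite e" if "e \<in> F" for e
  proof -
    have "e \<in> lattice_edges" using assms(2) that by auto
    then show ?thesis by (rule lattice_edgesE) simp
  qed
  then have "finite (\<Union>F)" using assms by auto
  then obtain n where "\<Union>F \<subseteq> box_vertices n" using finite_subset_box by blast
  then show ?thesis using assms by (auto simp: box_edges_def)
qed

text \<open>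
  The translate of the box of radius \<open>n + k\<close> by \<open>- x\<close> lies between the boxes of radii \<open>n\<close>
  and \<open>n + 2 * k\<close>.
\<close>

lemma inclusion_prob_translate_bounds:
  fixes x :: "int ^ 'd::finite"
  assumes k: "\<And>i :: 'd. \<bar>x $ i\<bar> \<le> int k" and F: "F \<subseteq> box_edges n"
  shows "inclusion_prob (box_vertices (n + 2 * k)) F
      \<le> inclusion_prob (box_vertices (n + k)) (edge_map (translate x) F)"
    and "inclusion_prob (box_vertices (n + k)) (edge_map (translate x) F)
      \<le> inclusion_prob (box_vertices n) F"
proof -
  define W where "W = translate (- x) ` box_vertices (n + k)"
  have W: "box_vertices (n + k) = translate x ` W" by (simp add: W_def image_image)
  have eq: "inclusion_prob (box_vertices (n + k)) (edge_map (translate x) F) = inclusion_prob W F"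
    unfolding W by (rule inclusion_prob_translate)
  have mem: "v \<in> W \<longleftrightarrow> v + x \<in> box_vertices (n + k)" for v
  proof
    show "v \<in> W \<Longrightarrow> v + x \<in> box_vertices (n + k)" by (auto simp: W_def translate_def)
    assume "v + x \<in> box_vertices (n + k)"
    then have "translate (- x) (v + x) \<in> W" unfolding W_def by blast
    then show "v \<in> W" by (simp add: translate_def)
  qed
  have sub1: "box_vertices n \<subseteq> W"
  proof
    fix v :: "int ^ 'd" assume v: "v \<in> box_vertices n"
    have "\<bar>v $ i + x $ i\<bar> \<le> int (n + k)" for i
    proof -
      have "\<bar>v $ i\<bar> \<le> int n" using v by (simp add: box_vertices_def)
      then show ?thesis using k[of i] by linarith
    qed
    then show "v \<in> W" unfolding mem by (simp add: box_vertices_def)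
  qed
  have sub2: "W \<subseteq> box_vertices (n + 2 * k)"
  proof
    fix v :: "int ^ 'd" assume "v \<in> W"
    then have v: "v + x \<in> box_vertices (n + k)" by (simp add: mem)
    have "\<bar>v $ i\<bar> \<le> int (n + 2 * k)" for i
    proof -
      have "\<bar>v $ i + x $ i\<bar> \<le> int (n + k)" using v by (simp add: box_vertices_def)
      then show ?thesis using k[of i] by linarith
    qed
    then show "v \<in> box_vertices (n + 2 * k)" by (simp add: box_vertices_def)
  qed
  have pos: "num_trees W (induced_edges W) {} > 0"
    using num_trees_translate[of "- x" "box_vertices (n + k)" "{}"] num_trees_box_pos by (simp add: W_def)
  have F1: "F \<subseteq> induced_edges (box_vertices n)" using F by (simp add: box_edges_eq)
  then have F2: "F \<subseteq> induced_edges W" using sub1 by (auto simp: induced_edges_def)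
  show "inclusion_prob (box_vertices (n + 2 * k)) F
      \<le> inclusion_prob (box_vertices (n + k)) (edge_map (translate x) F)"
    unfolding eq by (rule inclusion_prob_antimono[OF finite_box sub2 F2 pos num_trees_box_pos])
  show "inclusion_prob (box_vertices (n + k)) (edge_map (translate x) F)
      \<le> inclusion_prob (box_vertices n) F"
    unfolding eq
    by (rule inclusion_prob_antimono[OF _ sub1 F1 num_trees_box_pos pos]) (simp add: W_def finite_box)
qed

section \<open>Translation invariance of the limit\<close>

definition open_cylinder :: "(int ^ 'd::finite) set set \<Rightarrow> ((int ^ 'd) set \<Rightarrow> bool) set" where
  "open_cylinder F = {\<omega> \<in> space config_space. \<forall>e\<in>F. \<omega> e}"

lemma pred_edge: "e \<in> lattice_edges \<Longrightarrow> Measurable.pred config_space (\<lambda>\<omega>. \<omega> e)"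
  unfolding config_space_def by (rule measurable_component_singleton)

lemma sets_edge: "e \<in> lattice_edges \<Longrightarrow> {\<omega> \<in> space config_space. \<omega> e} \<in> sets config_space"
  using pred_edge by (simp add: pred_def)

lemma sets_open_cylinder:
  assumes "finite F" "F \<subseteq> lattice_edges" shows "open_cylinder F \<in> sets config_space"
  unfolding open_cylinder_def
  by (rule sets.sets_Collect_finite_All) (use assms sets_edge in auto)

lemma finitely_determined_open_cylinder:
  assumes "finite F" "F \<subseteq> lattice_edges" shows "finitely_determined (open_cylinder F)"
  unfolding finitely_determined_def
  using sets_open_cylinder[OF assms] assms by (auto simp: open_cylinder_def intro!: exI[of _ F])

lemma space_config: "space config_space = PiE lattice_edges (\<lambda>_. UNIV)"
  by (simp add: config_space_def space_PiM)

lemma config_of_space [simp]: "config_of T \<in> space config_space"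
  by (auto simp: space_config config_of_def)

lemma config_of_apply: "e \<in> lattice_edges \<Longrightarrow> config_of T e \<longleftrightarrow> e \<in> T"
  by (simp add: config_of_def)

lemma finite_box_trees: "finite (box_spanning_trees n)"
  unfolding box_spanning_trees_eq box_edges_eq
  by (rule finite_graph.finite_trees[OF finite_graph_induced[OF finite_box]])

lemma box_ust_measure:
  fixes C :: "((int ^ 'd::finite) set \<Rightarrow> bool) set"
  assumes "C \<in> sets config_space"
  shows "measure (box_ust n) C
    = real (card {T \<in> box_spanning_trees n. config_of T \<in> C}) / real (card (box_spanning_trees n :: (int ^ 'd) set set set))"
proof -
  have "measure (box_ust n) C
      = measure (uniform_count_measure (box_spanning_trees n)) {T \<in> box_spanning_trees n. config_of T \<in> C}"
    unfolding box_ust_def using assms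
    by (subst measure_distr)
      (auto simp: space_uniform_count_measure sets_uniform_count_measure intro!: measurableI
        arg_cong[where f = "measure _"])
  also have "\<dots> = real (card {T \<in> box_spanning_trees n. config_of T \<in> C}) / real (card (box_spanning_trees n :: (int ^ 'd) set set set))"
    by (subst measure_uniform_count_measure) (auto simp: finite_box_trees)
  finally show ?thesis .
qed

lemma box_ust_open_cylinder:
  assumes "finite F" "F \<subseteq> lattice_edges"
  shows "measure (box_ust n) (open_cylinder F) = inclusion_prob (box_vertices n) F"
proof -
  have "{T \<in> box_spanning_trees n. config_of T \<in> open_cylinder F}
      = spanning_trees (box_vertices n) (box_edges n) F"
    using assms(2) unfolding box_spanning_trees_eq
    by (auto simp: open_cylinder_def spanning_trees_def config_of_apply subset_iff)
  then show ?thesis using assms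
    by (simp add: box_ust_measure[OF sets_open_cylinder[OF assms]] inclusion_prob_def num_trees_def box_edges_eq
        box_spanning_trees_eq)
qed

lemma limiting_usf_open_cylinder:
  assumes "is_limiting_usf \<mu>" "finite F" "F \<subseteq> lattice_edges"
  shows "(\<lambda>n. inclusion_prob (box_vertices n) F) \<longlonglongrightarrow> measure \<mu> (open_cylinder F)"
  using assms finitely_determined_open_cylinder[OF assms(2,3)]
  unfolding is_limiting_usf_def by (auto simp flip: box_ust_open_cylinder)

text \<open>
  Both bounds of \<open>inclusion_prob_translate_bounds\<close> converge to the limiting probability of the
  cylinder, and the quantity between them to that of its translate.
\<close>

lemma limiting_usf_translate_cylinder:
  fixes \<mu> :: "((int ^ 'd::finite) set \<Rightarrow> bool) measure"
  assumes \<mu>: "is_limiting_usf \<mu>" and F: "finite F" "F \<subseteq> lattice_edges"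
  shows "measure \<mu> (open_cylinder (edge_map (translate x) F)) = measure \<mu> (open_cylinder F)"
proof -
  obtain k where "{x} \<subseteq> box_vertices k" using finite_subset_box[of "{x}"] by blast
  then have k: "\<And>i. \<bar>x $ i\<bar> \<le> int k" by (simp add: box_vertices_def)
  obtain n0 where n0: "F \<subseteq> box_edges n0" using finite_edges_subset_box[OF F] by blast
  have Fn: "F \<subseteq> box_edges n" if "n \<ge> n0" for n
    using n0 box_mono[OF that] by (fastforce simp: box_edges_def)
  have F': "finite (edge_map (translate x) F)" "edge_map (translate x) F \<subseteq> lattice_edges"
    using F by (auto simp: translate_image_lattice)
  note lim = limiting_usf_open_cylinder[OF \<mu> F]
  have "(\<lambda>n. inclusion_prob (box_vertices (n + k)) (edge_map (translate x) F))
      \<longlonglongrightarrow> measure \<mu> (open_cylinder F)"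
  proof (rule tendsto_sandwich)
    show "\<forall>\<^sub>F n in sequentially. inclusion_prob (box_vertices (n + 2 * k)) F
        \<le> inclusion_prob (box_vertices (n + k)) (edge_map (translate x) F)"
      using eventually_ge_at_top[of n0]
      by eventually_elim (rule inclusion_prob_translate_bounds(1)[OF k Fn])
    show "\<forall>\<^sub>F n in sequentially. inclusion_prob (box_vertices (n + k)) (edge_map (translate x) F)
        \<le> inclusion_prob (box_vertices n) F"
      using eventually_ge_at_top[of n0]
      by eventually_elim (rule inclusion_prob_translate_bounds(2)[OF k Fn])
    show "(\<lambda>n. inclusion_prob (box_vertices n) F) \<longlonglongrightarrow> measure \<mu> (open_cylinder F)" by (rule lim)
    show "(\<lambda>n. inclusion_prob (box_vertices (n + 2 * k)) F) \<longlonglongrightarrow> measure \<mu> (open_cylinder F)"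
      by (rule LIMSEQ_ignore_initial_segment[OF lim])
  qed
  moreover have "(\<lambda>n. inclusion_prob (box_vertices (n + k)) (edge_map (translate x) F))
      \<longlonglongrightarrow> measure \<mu> (open_cylinder (edge_map (translate x) F))"
    by (rule LIMSEQ_ignore_initial_segment[OF limiting_usf_open_cylinder[OF \<mu> F']])
  ultimately show ?thesis by (metis LIMSEQ_unique)
qed

definition translate_config ::
    "int ^ 'd::finite \<Rightarrow> ((int ^ 'd) set \<Rightarrow> bool) \<Rightarrow> (int ^ 'd) set \<Rightarrow> bool" where
  "translate_config x \<omega> = (\<lambda>e\<in>lattice_edges. \<omega> (translate x ` e))"

lemma measurable_translate_config: "translate_config x \<in> config_space \<rightarrow>\<^sub>M config_space"
  unfolding translate_config_def config_space_def
  by (rule measurable_restrict, rule measurable_component_singleton) (simp add: translate_image_lattice)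

text \<open>
  Events that prescribe the presence of edges suffice, as the absence of an edge is a complement.
\<close>

lemma sets_config_generated:
  "sets (config_space :: ((int ^ 'd::finite) set \<Rightarrow> bool) measure)
    = sigma_sets (space config_space) (open_cylinder ` {F. finite F \<and> F \<subseteq> lattice_edges})"
    (is "_ = sigma_sets ?\<Omega> ?G")
proof (rule antisym)
  show "sigma_sets ?\<Omega> ?G \<subseteq> sets config_space"
    by (rule sets.sigma_sets_subset) (auto intro: sets_open_cylinder)
  interpret sigma_algebra ?\<Omega> "sigma_sets ?\<Omega> ?G"
    by (rule sigma_algebra_sigma_sets) (auto simp: open_cylinder_def)
  have "{f \<in> ?\<Omega>. f i \<in> A} \<in> sigma_sets ?\<Omega> ?G" if "i \<in> lattice_edges" for i A
  proof -
    have c: "open_cylinder {i} \<in> sigma_sets ?\<Omega> ?G"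
      using that by (intro sigma_sets.Basic) auto
    consider "True \<in> A" "False \<in> A" | "True \<in> A" "False \<notin> A" | "True \<notin> A" "False \<in> A"
      | "True \<notin> A" "False \<notin> A" by blast
    then show ?thesis
    proof cases
      case 1
      then have "{f \<in> ?\<Omega>. f i \<in> A} = ?\<Omega>" by (auto, metis (full_types))
      then show ?thesis by auto
    next
      case 2
      then have "b \<in> A \<longleftrightarrow> b" for b by (cases b) auto
      then have "{f \<in> ?\<Omega>. f i \<in> A} = open_cylinder {i}" by (auto simp: open_cylinder_def)
      then show ?thesis using c by auto
    next
      case 3
      then have "b \<in> A \<longleftrightarrow> \<not> b" for b by (cases b) auto
      then have "{f \<in> ?\<Omega>. f i \<in> A} = ?\<Omega> - open_cylinder {i}" by (auto simp: open_cylinder_def)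
      then show ?thesis using c by auto
    next
      case 4
      then have "b \<notin> A" for b by (cases b) auto
      then have "{f \<in> ?\<Omega>. f i \<in> A} = {}" by auto
      then show ?thesis by (simp only: sigma_sets.Empty)
    qed
  qed
  then show "sets config_space \<subseteq> sigma_sets ?\<Omega> ?G"
    unfolding config_space_def sets_PiM_single space_PiM
    by (intro sigma_sets_mono) (auto simp: config_space_def space_PiM)
qed

lemma limiting_usf_translate_invariant:
  fixes \<mu> :: "((int ^ 'd::finite) set \<Rightarrow> bool) measure"
  assumes \<mu>: "is_limiting_usf \<mu>"
  shows "distr \<mu> config_space (translate_config x) = \<mu>"
proof -
  interpret prob_space \<mu> using \<mu> by (simp add: is_limiting_usf_def)
  have sets_\<mu>: "sets \<mu> = sets config_space" using \<mu> by (simp add: is_limiting_usf_def)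
  then have sp: "space \<mu> = space config_space" by (rule sets_eq_imp_space_eq)
  have m: "translate_config x \<in> \<mu> \<rightarrow>\<^sub>M config_space"
    unfolding measurable_cong_sets[OF sets_\<mu> refl] by (rule measurable_translate_config)
  let ?G = "open_cylinder ` {F. finite F \<and> F \<subseteq> (lattice_edges :: (int ^ 'd) set set)}"
  show ?thesis
  proof (rule measure_eqI_generator_eq[where \<Omega> = "space config_space" and E = ?G
        and A = "\<lambda>_. space config_space"])
    show "Int_stable ?G"
    proof (rule Int_stableI_image)
      fix F F' :: "(int ^ 'd) set set"
      assume "F \<in> {F. finite F \<and> F \<subseteq> lattice_edges}" "F' \<in> {F. finite F \<and> F \<subseteq> lattice_edges}"
      then show "\<exists>H\<in>{F. finite F \<and> F \<subseteq> lattice_edges}.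
          open_cylinder F \<inter> open_cylinder F' = open_cylinder H"
        by (intro bexI[of _ "F \<union> F'"]) (auto simp: open_cylinder_def)
    qed
    show "?G \<subseteq> Pow (space config_space)" by (auto simp: open_cylinder_def)
    show "emeasure (distr \<mu> config_space (translate_config x)) X = emeasure \<mu> X" if "X \<in> ?G" for X
    proof -
      from that obtain F where F: "finite F" "F \<subseteq> lattice_edges" "X = open_cylinder F" by auto
      have "translate_config x -` X \<inter> space \<mu> = open_cylinder (edge_map (translate x) F)"
        using F measurable_space[OF measurable_translate_config, of _ x]
        by (auto simp: open_cylinder_def sp translate_config_def subset_iff)
      then have "emeasure (distr \<mu> config_space (translate_config x)) X
          = emeasure \<mu> (open_cylinder (edge_map (translate x) F))"
        using F m by (subst emeasure_distr) (auto intro: sets_open_cylinder)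
      also have "\<dots> = emeasure \<mu> X"
        using limiting_usf_translate_cylinder[OF \<mu> F(1,2), of x] F by (simp add: emeasure_eq_measure)
      finally show ?thesis .
    qed
    show "sets (distr \<mu> config_space (translate_config x)) = sigma_sets (space config_space) ?G"
      by (simp add: sets_config_generated)
    show "sets \<mu> = sigma_sets (space config_space) ?G"
      using sets_\<mu> by (simp add: sets_config_generated)
    have "open_cylinder {} = space config_space" by (auto simp: open_cylinder_def)
    then show "range (\<lambda>_. space config_space) \<subseteq> ?G" by force
    show "emeasure (distr \<mu> config_space (translate_config x)) (space config_space) \<noteq> \<infinity>"
      using prob_space.emeasure_space_1[OF prob_space_distr[OF m]] by simp
  qed auto
qed

definition branch :: "'v set set \<Rightarrow> 'v \<Rightarrow> 'v \<Rightarrow> 'v set" where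
  "branch T x y = {w. conn (T - {{x, y}}) y w}"

section \<open>In a locally finite forest these are the edges that lie on a two-sided infinite self-avoiding path.\<close>

definition core :: "'v set set \<Rightarrow> 'v set set" where
  "core T = {{x, y} | x y. {x, y} \<in> T \<and> infinite (branch T x y) \<and> infinite (branch T y x)}"

lemma core_iff:
  "{x, y} \<in> core T \<longleftrightarrow> {x, y} \<in> T \<and> infinite (branch T x y) \<and> infinite (branch T y x)"
  by (auto simp: core_def doubleton_eq_iff insert_commute)

lemma core_subset: "core T \<subseteq> T"
  by (auto simp: core_def)

text \<open>
  Everything reachable from \<open>x\<close> in \<open>S\<close> is \<open>x\<close> itself or lies in one of the finitely many
  branches at \<open>x\<close>. This is the step of Koenig's lemma; with \<open>S\<close> omitting an edge at \<open>x\<close> it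
  continues a walk without turning back.
\<close>

lemma infinite_branch_step:
  assumes inf: "infinite {w. conn S x w}" and ST: "S \<subseteq> T" and fin: "finite {y. {x, y} \<in> T}"
  shows "\<exists>y. {x, y} \<in> S \<and> infinite (branch T x y)"
proof (rule ccontr)
  assume "\<not> ?thesis"
  then have "finite (branch T x y)" if "{x, y} \<in> S" for y using that by auto
  moreover have "finite {y. {x, y} \<in> S}" by (rule finite_subset[OF _ fin]) (use ST in auto)
  ultimately have "finite ({x} \<union> (\<Union>y\<in>{y. {x, y} \<in> S}. branch T x y))" by auto
  moreover have "{w. conn S x w} \<subseteq> {x} \<union> (\<Union>y\<in>{y. {x, y} \<in> S}. branch T x y)"
  proof clarify
    fix w assume "conn S x w" "w \<notin> (\<Union>y\<in>{y. {x, y} \<in> S}. branch T x y)"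
    then have "w = x \<or> w \<in> (\<Union>y\<in>{y. {x, y} \<in> S}. branch T x y)"
    proof (induction rule: conn_induct)
      case (step u v)
      show ?case
      proof (cases "u = x")
        case True
        then show ?thesis using step.hyps by (auto simp: branch_def)
      next
        case False
        then obtain y where y: "{x, y} \<in> S" "conn (T - {{x, y}}) y u"
          using step by (auto simp: branch_def)
        show ?thesis
        proof (cases "{u, v} = {x, y}")
          case True
          then show ?thesis using y False by (auto simp: doubleton_eq_iff branch_def)
        next
          case False
          then have "{u, v} \<in> T - {{x, y}}" using step.hyps ST by auto
          then show ?thesis using y conn_step by (fastforce simp: branch_def)
        qed
      qed
    qed simp
    then show "w = x" using \<open>w \<notin> _\<close> by blast
  qed
  ultimately show False using inf infinite_super by metis
qed

text \<open>
  The infinite branch behind \<open>x\<close>, seen from \<open>y\<close>, continues in an infinite branch along another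
  edge \<open>{x, w}\<close>. The side of \<open>x\<close> after removal of \<open>{x, w}\<close> is infinite as well, because it
  contains the branch along \<open>{x, y}\<close>.
\<close>

lemma core_no_leaf:
  assumes T: "no_detour T" and fin: "finite {y. {x, y} \<in> T}" and xy: "{x, y} \<in> core T"
  shows "\<exists>w. w \<noteq> y \<and> {x, w} \<in> core T"
proof -
  let ?S = "T - {{x, y}}"
  have inf: "infinite {w. conn ?S x w}" "infinite (branch T x y)" and e: "{x, y} \<in> T"
    using xy by (auto simp: core_iff branch_def insert_commute)
  from infinite_branch_step[OF inf(1) _ fin] obtain w
    where w: "{x, w} \<in> ?S" "infinite (branch T x w)" by auto
  have sub: "branch T x y \<subseteq> branch T w x"
  proof
    fix u assume "u \<in> branch T x y"
    then have "conn ?S y u" by (simp add: branch_def)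
    then have "conn (T - {{w, x}}) x u"
    proof (induction rule: conn_induct)
      case refl
      have "{x, y} \<in> T - {{w, x}}" using e w by (auto simp: insert_commute)
      then show ?case by (rule conn_edge)
    next
      case (step u v)
      have "{u, v} \<noteq> {w, x}"
      proof
        assume "{u, v} = {w, x}"
        then have "u = x \<or> u = w" by (auto simp: doubleton_eq_iff)
        then have "conn ?S x y" using step.hyps(1) w(1)
          by (metis conn_edge conn_sym conn_trans)
        then show False using T e no_detourD by metis
      qed
      then show ?case using step conn_step by (metis Diff_iff singletonD)
    qed
    then show "u \<in> branch T w x" by (simp add: branch_def)
  qed
  have "infinite (branch T w x)" using infinite_super[OF sub inf(2)] .
  then have "{x, w} \<in> core T" using w by (simp add: core_iff)
  moreover have "w \<noteq> y" using w(1) by auto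
  ultimately show ?thesis by blast
qed

section \<open>Rays and branch points\<close>

definition nonbacktracking :: "'v set set \<Rightarrow> (nat \<Rightarrow> 'v) \<Rightarrow> bool" where
  "nonbacktracking T p \<longleftrightarrow> (\<forall>i. {p i, p (Suc i)} \<in> T \<and> p (Suc (Suc i)) \<noteq> p i)"

text \<open>
  A walk that returned across its starting edge would either provide a detour around that edge, or
  first return to \<open>p (Suc i)\<close>. The latter is excluded by the claim for the shorter walk that starts
  at \<open>Suc i\<close>, which explains the induction on \<open>j - i\<close>.
\<close>

lemma nonbacktracking_branch:
  assumes T: "no_detour T" and p: "nonbacktracking T p" and "i < j"
  shows "p j \<in> branch T (p i) (p (Suc i))"
  using assms(3)
proof (induction "j - i" arbitrary: i j rule: less_induct)
  case (less i j)
  let ?f = "{p i, p (Suc i)}"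
  have e: "{p k, p (Suc k)} \<in> T" "p (Suc (Suc k)) \<noteq> p k" for k
    using p by (auto simp: nonbacktracking_def)
  obtain k where j: "j = Suc k" using less.prems by (cases j) auto
  show ?case
  proof (cases "k = i")
    case True
    then show ?thesis by (simp add: j branch_def)
  next
    case False
    then have ik: "i < k" using less.prems j by auto
    have IH: "conn (T - {?f}) (p (Suc i)) (p k)"
      using less.hyps[of k i] ik j by (simp add: branch_def)
    have "{p k, p (Suc k)} \<noteq> ?f"
    proof
      assume "{p k, p (Suc k)} = ?f"
      then consider "p k = p i" | "p k = p (Suc i)" "p (Suc k) = p i"
        by (auto simp: doubleton_eq_iff)
      then show False
      proof cases
        case 1
        then show ?thesis using IH no_detourD[OF T e(1)] conn_sym by metis
      next
        case 2
        then have "k \<noteq> Suc i" using e(2)[of i] by auto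
        then have "Suc i < k" using ik by auto
        then have "conn (T - {{p (Suc i), p (Suc (Suc i))}}) (p (Suc (Suc i))) (p (Suc i))"
          using less.hyps[of k "Suc i"] j 2 by (simp add: branch_def)
        then show ?thesis using no_detourD[OF T e(1)] conn_sym by metis
      qed
    qed
    then have "{p k, p (Suc k)} \<in> T - {?f}" using e(1) by auto
    then show ?thesis using conn_step[OF IH] by (simp add: j branch_def)
  qed
qed

lemma nonbacktracking_inj:
  assumes T: "no_detour T" and p: "nonbacktracking T p"
  shows "inj p"
proof (rule linorder_injI)
  fix i j :: nat assume "i < j"
  then have "conn (T - {{p i, p (Suc i)}}) (p (Suc i)) (p j)"
    using nonbacktracking_branch[OF T p] by (simp add: branch_def)
  then show "p i \<noteq> p j"
    using no_detourD[OF T, of "p i" "p (Suc i)"] p conn_sym by (metis nonbacktracking_def)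
qed

lemma nonbacktracking_infinite_branch:
  assumes T: "no_detour T" and p: "nonbacktracking T p"
  shows "infinite (branch T (p 0) (p 1))"
proof -
  have "range (\<lambda>j. p (Suc j)) \<subseteq> branch T (p 0) (p 1)"
    using nonbacktracking_branch[OF T p, of 0] by auto
  moreover have "infinite (range (\<lambda>j. p (Suc j)))"
    using nonbacktracking_inj[OF T p] by (intro range_inj_infinite) (auto simp: inj_def)
  ultimately show ?thesis by (rule infinite_super)
qed

text \<open>
  The two walks start along the same edge in opposite directions and fill the two sides.
\<close>

lemma core_nonbacktracking:
  assumes T: "no_detour T" and p: "nonbacktracking T p" and q: "nonbacktracking T q"
    and "q 0 = p 1" "q 1 = p 0"
  shows "{p 0, p 1} \<in> core T"
  using nonbacktracking_infinite_branch[OF T p] nonbacktracking_infinite_branch[OF T q] p assms(4,5)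
  by (auto simp: core_iff nonbacktracking_def)

lemma rays_from_iff:
  assumes "no_detour T"
  shows "p \<in> rays_from T x \<longleftrightarrow> p 0 = x \<and> nonbacktracking T p"
proof
  assume "p \<in> rays_from T x"
  then show "p 0 = x \<and> nonbacktracking T p"
    by (auto simp: rays_from_def nonbacktracking_def inj_eq)
next
  assume "p 0 = x \<and> nonbacktracking T p"
  then show "p \<in> rays_from T x" using nonbacktracking_inj[OF assms]
    by (auto simp: rays_from_def nonbacktracking_def)
qed

lemma ray_exists:
  assumes T: "no_detour T" and fin: "\<And>x. finite {y. {x, y} \<in> T}" and inf: "infinite {w. conn T x w}"
  shows "rays_from T x \<noteq> {}"
proof -
  define P where "P n uv \<longleftrightarrow> {fst uv, snd uv} \<in> T \<and> infinite (branch T (fst uv) (snd uv))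
    \<and> (n = 0 \<longrightarrow> fst uv = x)" for n :: nat and uv
  have "\<exists>f. \<forall>n. P n (f n) \<and> fst (f (Suc n)) = snd (f n) \<and> snd (f (Suc n)) \<noteq> fst (f n)"
  proof (rule dependent_nat_choice)
    show "\<exists>uv. P 0 uv" using infinite_branch_step[OF inf order_refl fin] by (auto simp: P_def)
    fix uv n assume uv: "P n uv"
    let ?S = "T - {{fst uv, snd uv}}"
    have "infinite {w. conn ?S (snd uv) w}" using uv by (simp add: P_def branch_def)
    from infinite_branch_step[OF this _ fin] obtain w
      where w: "{snd uv, w} \<in> ?S" "infinite (branch T (snd uv) w)" by auto
    show "\<exists>vw. P (Suc n) vw \<and> fst vw = snd uv \<and> snd vw \<noteq> fst uv"
      by (rule exI[of _ "(snd uv, w)"]) (use w in \<open>auto simp: P_def insert_commute\<close>)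
  qed
  then obtain f where f: "\<And>n. P n (f n)" "\<And>n. fst (f (Suc n)) = snd (f n)"
    "\<And>n. snd (f (Suc n)) \<noteq> fst (f n)" by blast
  have "nonbacktracking T (\<lambda>n. fst (f n))"
    using f by (auto simp: nonbacktracking_def P_def)
  moreover have "fst (f 0) = x" using f(1)[of 0] by (simp add: P_def)
  ultimately show ?thesis using rays_from_iff[OF T] by blast
qed

text \<open>
  Walking back along \<open>p\<close> from \<open>p (Suc j)\<close> to the place of separation and then out along \<open>q\<close>
  is a walk without backtracking, so the side behind the edge is infinite; the side ahead contains
  the rest of \<open>p\<close>.
\<close>

lemma core_after_split:
  assumes T: "no_detour T" and p: "p \<in> rays_from T x" and q: "q \<in> rays_from T x"
    and agree: "p k = q k" and split: "p (Suc k) \<noteq> q (Suc k)" and j: "k \<le> j"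
  shows "{p j, p (Suc j)} \<in> core T"
proof -
  have p': "inj p" "\<And>i. {p i, p (Suc i)} \<in> T" and q': "inj q" "\<And>i. {q i, q (Suc i)} \<in> T"
    using p q by (auto simp: rays_from_def)
  \<comment> \<open>The walk \<open>w\<close> follows \<open>p\<close> backwards for \<open>L\<close> steps.\<close>
  define L where "L = Suc j - k"
  have L: "L \<ge> 1" "Suc j = L + k" using j by (auto simp: L_def)
  define w where "w = (\<lambda>n. if n \<le> L then p (Suc j - n) else q (n - L + k))"
  have w_q: "w n = q (n - L + k)" if "n \<ge> L" for n
    using that agree L by (auto simp: w_def)
  have w_p: "w n = p (Suc j - n)" if "n \<le> L" for n
    using that by (simp add: w_def)
  have "nonbacktracking T w" unfolding nonbacktracking_def
  proof (intro allI conjI)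
    fix n
    show "{w n, w (Suc n)} \<in> T"
    proof (cases "n < L")
      case True
      then have "Suc j - n = Suc (Suc j - Suc n)" using L by auto
      then show ?thesis using True p'(2)[of "Suc j - Suc n"] by (simp add: w_p insert_commute)
    next
      case False
      then show ?thesis using q'(2)[of "n - L + k"] by (simp add: w_q Suc_diff_le)
    qed
    show "w (Suc (Suc n)) \<noteq> w n"
    proof -
      consider "Suc (Suc n) \<le> L" | "Suc n = L" | "L \<le> n" by linarith
      then show ?thesis
      proof cases
        case 1
        then show ?thesis using L p'(1) by (auto simp: w_p inj_eq)
      next
        case 2
        then have "Suc j - n = Suc k" "Suc (Suc n) - L + k = Suc k" using L by auto
        then show ?thesis using 2 split w_q[of "Suc (Suc n)"] w_p[of n] by auto
      next
        case 3
        then show ?thesis using q'(1) by (auto simp: w_q inj_eq)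
      qed
    qed
  qed
  moreover have "nonbacktracking T (\<lambda>n. p (j + n))"
    using p' by (auto simp: nonbacktracking_def inj_eq)
  moreover have "w 0 = p (Suc j)" "w 1 = p j" using L(1) by (auto simp: w_p)
  ultimately show ?thesis using core_nonbacktracking[OF T, of "\<lambda>n. p (j + n)" w] by simp
qed

definition branch_point :: "'v set set \<Rightarrow> 'v \<Rightarrow> bool" where
  "branch_point T z \<longleftrightarrow> (\<exists>a b c. a \<noteq> b \<and> a \<noteq> c \<and> b \<noteq> c \<and>
     {z, a} \<in> core T \<and> {z, b} \<in> core T \<and> {z, c} \<in> core T)"

definition split_at :: "(nat \<Rightarrow> 'v) \<Rightarrow> (nat \<Rightarrow> 'v) \<Rightarrow> nat \<Rightarrow> bool" where
  "split_at p q k \<longleftrightarrow> (\<forall>i\<le>k. p i = q i) \<and> p (Suc k) \<noteq> q (Suc k)"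

lemma split_at_exists:
  assumes "p 0 = q 0" "p \<noteq> q" shows "\<exists>k. split_at p q k"
proof -
  have ex: "\<exists>n. p n \<noteq> q n" using assms(2) by auto
  define n where "n = (LEAST n. p n \<noteq> q n)"
  have n: "p n \<noteq> q n" "\<And>i. i < n \<Longrightarrow> p i = q i"
    unfolding n_def using LeastI_ex[OF ex] not_less_Least by auto
  then obtain k where "n = Suc k" using assms(1) by (cases n) auto
  then show ?thesis using n by (auto simp: split_at_def less_Suc_eq_le)
qed

lemma split_at_sym: "split_at p q k \<Longrightarrow> split_at q p k"
  by (auto simp: split_at_def)

lemma core_split_at:
  assumes "no_detour T" "p \<in> rays_from T x" "q \<in> rays_from T x" "split_at p q k" "k \<le> j"
  shows "{p j, p (Suc j)} \<in> core T"
  using core_after_split[OF assms(1-3), of k j] assms(4,5) by (auto simp: split_at_def)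

text \<open>
  At the later of two separations there are two ways forward, and the way back leads to the earlier
  separation and from there to infinity.
\<close>

lemma branch_point_nested_splits:
  assumes T: "no_detour T" and rays: "p \<in> rays_from T x" "q \<in> rays_from T x" "r \<in> rays_from T x"
    and pq: "split_at p q m" and pr: "split_at p r k" and "k < m"
  shows "\<exists>z. branch_point T z"
proof -
  obtain m' where m: "m = Suc m'" using \<open>k < m\<close> by (cases m) auto
  have eq: "q m = p m" "q m' = p m'" and ne: "p (Suc m) \<noteq> q (Suc m)"
    using pq m by (auto simp: split_at_def)
  have inj: "inj p" "inj q" using rays by (auto simp: rays_from_def)
  have "{p m', p (Suc m')} \<in> core T" using core_split_at[OF T rays(1,3) pr, of m'] \<open>k < m\<close> m by auto
  then have 1: "{p m, p m'} \<in> core T" by (simp add: m insert_commute)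
  have 2: "{p m, p (Suc m)} \<in> core T" using core_split_at[OF T rays(1,2) pq] by auto
  have 3: "{p m, q (Suc m)} \<in> core T"
    using core_split_at[OF T rays(2,1) split_at_sym[OF pq], of m] eq by auto
  have "p m' \<noteq> p (Suc m)" using inj m by (auto simp: inj_eq)
  moreover have "p m' \<noteq> q (Suc m)" using inj m eq by (metis Suc_n_not_le_n inj_eq le_SucI order_refl)
  ultimately show ?thesis unfolding branch_point_def using 1 2 3 ne by metis
qed

text \<open>
  If two of the three separations occur at different times, the previous lemma applies. Otherwise all
  three rays separate at the same vertex.
\<close>

lemma branch_point_three_rays:
  assumes T: "no_detour T" and rays: "p \<in> rays_from T x" "q \<in> rays_from T x" "r \<in> rays_from T x"
    and ne: "p \<noteq> q" "p \<noteq> r" "q \<noteq> r"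
  shows "\<exists>z. branch_point T z"
proof -
  have start: "p 0 = x" "q 0 = x" "r 0 = x" using rays by (auto simp: rays_from_def)
  obtain m where pq: "split_at p q m" using split_at_exists[of p q] start ne by auto
  obtain k where pr: "split_at p r k" using split_at_exists[of p r] start ne by auto
  obtain l where qr: "split_at q r l" using split_at_exists[of q r] start ne by auto
  consider "k < m" | "m < k" | "k = m" "m < l" | "k = m" "l \<le> m" by linarith
  then show ?thesis
  proof cases
    case 1
    then show ?thesis using branch_point_nested_splits[OF T rays pq pr] by blast
  next
    case 2
    then show ?thesis using branch_point_nested_splits[OF T rays(1,3,2) pr pq] by blast
  next
    case 3
    then show ?thesis
      using branch_point_nested_splits[OF T rays(2,3,1) qr split_at_sym[OF pq]] by blast
  next
    case 4
    have eq: "p m = q m" "p m = r m" using pq pr 4 by (auto simp: split_at_def)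
    have "l = m"
    proof (rule ccontr)
      assume "l \<noteq> m"
      then have "q (Suc l) = p (Suc l)" "p (Suc l) = r (Suc l)"
        using pq pr 4 by (auto simp: split_at_def)
      then show False using qr by (auto simp: split_at_def)
    qed
    then have d: "p (Suc m) \<noteq> q (Suc m)" "p (Suc m) \<noteq> r (Suc m)" "q (Suc m) \<noteq> r (Suc m)"
      using pq pr qr 4 by (auto simp: split_at_def)
    have "{p m, p (Suc m)} \<in> core T" using core_split_at[OF T rays(1,2) pq, of m] by auto
    moreover have "{p m, q (Suc m)} \<in> core T"
      using core_split_at[OF T rays(2,1) split_at_sym[OF pq], of m] eq by auto
    moreover have "{p m, r (Suc m)} \<in> core T"
      using core_split_at[OF T rays(3,1) split_at_sym[OF pr], of m] eq 4 by auto
    ultimately show ?thesis using d unfolding branch_point_def by metis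
  qed
qed

lemma card_rays_le_2:
  assumes T: "no_detour T" and no: "\<And>z. \<not> branch_point T z"
  shows "finite (rays_from T x) \<and> card (rays_from T x) \<le> 2"
proof (rule ccontr)
  assume "\<not> ?thesis"
  then have "infinite (rays_from T x) \<or> card (rays_from T x) \<ge> 3" by auto
  then have "\<exists>R\<subseteq>rays_from T x. card R = 3"
  proof
    assume "infinite (rays_from T x)"
    from infinite_arbitrarily_large[OF this, of 3] show ?thesis by auto
  next
    assume "card (rays_from T x) \<ge> 3"
    then obtain R where "R \<subseteq> rays_from T x" "card R = 3" by (rule obtain_subset_with_card_n)
    then show ?thesis by auto
  qed
  then obtain R where "R \<subseteq> rays_from T x" "card R = 3" by blast
  then obtain p q r where "p \<in> rays_from T x" "q \<in> rays_from T x" "r \<in> rays_from T x"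
    "p \<noteq> q" "p \<noteq> r" "q \<noteq> r" by (auto simp: card_3_iff)
  then show False using branch_point_three_rays[OF T] no by metis
qed

text \<open>
  In a forest this is the bijection from the rays at a neighbour of \<open>y\<close> to the rays at
  \<open>y\<close>.
\<close>

definition reroot :: "'v \<Rightarrow> (nat \<Rightarrow> 'v) \<Rightarrow> nat \<Rightarrow> 'v" where
  "reroot y p = (if p 1 = y then p \<circ> Suc else case_nat y p)"

lemma reroot_ray:
  assumes T: "no_detour T" and xy: "{x, y} \<in> T" and p: "p \<in> rays_from T x"
  shows "reroot y p \<in> rays_from T y" "reroot x (reroot y p) = p"
proof -
  have p0: "p 0 = x" and nb: "\<And>i. {p i, p (Suc i)} \<in> T" "\<And>i. p (Suc (Suc i)) \<noteq> p i"
    using p rays_from_iff[OF T] by (auto simp: nonbacktracking_def)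
  have "nonbacktracking T (reroot y p) \<and> reroot y p 0 = y"
    using nb xy p0
    by (auto simp: nonbacktracking_def reroot_def insert_commute split: nat.split)
  then show "reroot y p \<in> rays_from T y" using rays_from_iff[OF T] by blast
  have "p (Suc (Suc 0)) \<noteq> x" using nb(2)[of 0] p0 by simp
  then show "reroot x (reroot y p) = p"
    using p0 by (auto simp: reroot_def fun_eq_iff split: nat.split)
qed

lemma bij_betw_reroot:
  assumes T: "no_detour T" and xy: "{x, y} \<in> T"
  shows "bij_betw (reroot y) (rays_from T x) (rays_from T y)"
proof (rule bij_betwI[where g = "reroot x"])
  have yx: "{y, x} \<in> T" using xy by (simp add: insert_commute)
  show "reroot y \<in> rays_from T x \<rightarrow> rays_from T y" "reroot x \<in> rays_from T y \<rightarrow> rays_from T x"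
    using reroot_ray[OF T xy] reroot_ray[OF T yx] by auto
qed (use reroot_ray[OF T xy] reroot_ray[OF T, of y x] xy in \<open>auto simp: insert_commute\<close>)

text \<open>
  The number of rays is the same for neighbouring vertices by \<open>bij_betw_reroot\<close>, hence constant on
  each component.
\<close>

lemma has_ends_one_or_two:
  assumes T: "no_detour T" and fin: "\<And>x. finite {y. {x, y} \<in> T}"
    and inf: "\<And>x. infinite {w. conn T x w}" and no: "\<And>z. \<not> branch_point T z"
    and C: "C \<in> components_of T"
  shows "has_ends T C 1 \<or> has_ends T C 2"
proof -
  from C obtain x where x: "C = {y. conn T x y}"
    by (auto simp: components_of_def quotient_def conn_def)
  have eq: "card (rays_from T y) = card (rays_from T x)" if "conn T x y" for y
    using that
    by (induction rule: conn_induct) (auto dest: bij_betw_same_card[OF bij_betw_reroot[OF T]])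
  have "card (rays_from T x) \<noteq> 0" "card (rays_from T x) \<le> 2"
    using card_rays_le_2[OF T no, of x] ray_exists[OF T fin inf, of x] by auto
  then have "card (rays_from T x) = 1 \<or> card (rays_from T x) = 2" by linarith
  moreover have "has_ends T C (card (rays_from T x))"
    unfolding has_ends_def x using conjunct1[OF card_rays_le_2[OF T no]] by (blast intro: eq)
  ultimately show ?thesis by (elim disjE) simp_all
qed

section \<open>Counting branch points\<close>

definition cluster :: "'v set \<Rightarrow> 'v set set \<Rightarrow> 'v \<Rightarrow> 'v set" where
  "cluster W F v = {w \<in> W. conn F v w}"

text \<open>
  In an acyclic graph every new edge merges two clusters, which start out as singletons.
\<close>

lemma card_forest_clusters:
  assumes W: "finite W" and "finite F" and "\<And>e. e \<in> F \<Longrightarrow> \<exists>x\<in>W. \<exists>y\<in>W. e = {x, y}"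
    and "no_detour F"
  shows "card F + card (cluster W F ` W) \<le> card W"
  using assms(2-)
proof (induction F rule: finite_induct)
  case empty
  show ?case using card_image_le[OF W] by simp
next
  case (insert e F)
  obtain x y where e: "e = {x, y}" "x \<in> W" "y \<in> W" using insert.prems(1) by blast
  let ?F = "insert e F"
  have eF: "?F - {{x, y}} = F" using insert.hyps e by auto
  have nxy: "\<not> conn F x y" using no_detourD[OF insert.prems(2), of x y] eF e by auto
  have IH: "card F + card (cluster W F ` W) \<le> card W"
    using insert.IH insert.prems no_detour_subset[OF insert.prems(2), of F] by auto
  define g where "g = (\<lambda>C. {w \<in> W. \<exists>v\<in>C. conn ?F v w})"
  have g: "g (cluster W F v) = cluster W ?F v" if "v \<in> W" for v
  proof -
    have "conn F v u \<Longrightarrow> conn ?F v u" for u by (erule conn_mono) auto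
    then show ?thesis using that unfolding g_def cluster_def by (auto intro: conn_trans)
  qed
  have "conn ?F x y" using conn_edge e by (metis insertI1)
  then have gxy: "cluster W ?F x = cluster W ?F y"
    unfolding cluster_def using conn_sym conn_trans by metis
  have "y \<in> cluster W F y" "y \<notin> cluster W F x" using nxy e(3) by (simp_all add: cluster_def)
  then have ne: "cluster W F x \<noteq> cluster W F y" by metis
  have "cluster W ?F ` W \<subseteq> g ` (cluster W F ` W - {cluster W F y})"
  proof
    fix D assume "D \<in> cluster W ?F ` W"
    then obtain v where v: "v \<in> W" "D = cluster W ?F v" by auto
    show "D \<in> g ` (cluster W F ` W - {cluster W F y})"
    proof (cases "cluster W F v = cluster W F y")
      case True
      then have "D = g (cluster W F x)" using v g[OF v(1)] g[OF e(2)] g[OF e(3)] gxy by simp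
      then show ?thesis using ne e by blast
    next
      case False
      then show ?thesis using v g[OF v(1)] by blast
    qed
  qed
  then have "card (cluster W ?F ` W) \<le> card (g ` (cluster W F ` W - {cluster W F y}))"
    using W by (intro card_mono) auto
  also have "\<dots> \<le> card (cluster W F ` W - {cluster W F y})" using W by (intro card_image_le) auto
  also have "\<dots> < card (cluster W F ` W)"
    using W e by (intro psubset_card_mono) auto
  finally show ?case using IH insert.hyps by simp
qed

text \<open>
  Let \<open>F\<close> consist of the core edges that meet \<open>B\<close>. Vertices of \<open>B\<close> have in \<open>F\<close> the same
  degree as in the core, which is never 1. Thus every vertex of \<open>B\<close> on \<open>F\<close> has degree at least
  2, and branch points have degree at least 3. As the degrees add up to twice the number of edges,
  which is at most twice the number of vertices, each branch point must be compensated by vertices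
  outside \<open>B\<close>, and these lie in \<open>D\<close>.
\<close>

lemma card_branch_points_le:
  fixes T :: "'v set set"
  assumes T: "no_detour T" and simple: "simple_edges T" and fin: "\<And>x. finite {y. {x, y} \<in> T}"
    and B: "finite B" and D: "finite D" and nbr: "\<And>x y. x \<in> B \<Longrightarrow> {x, y} \<in> T \<Longrightarrow> y \<in> B \<union> D"
    and BD: "B \<inter> D = {}"
  shows "card {z \<in> B. branch_point T z} \<le> 2 * card D"
proof -
  define F where "F = {e \<in> core T. e \<inter> B \<noteq> {}}"
  define W where "W = \<Union>F"
  have Fe: "\<exists>x y. x \<noteq> y \<and> x \<in> B \<and> y \<in> B \<union> D \<and> e = {x, y}" if eF: "e \<in> F" for e
  proof -
    have "e \<in> T" using eF core_subset by (auto simp: F_def)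
    then obtain x y where xy: "x \<noteq> y" "e = {x, y}" using simple by (auto simp: simple_edges_def)
    then consider "x \<in> B" | "y \<in> B" using eF by (auto simp: F_def)
    then show ?thesis
    proof cases
      case 1
      then show ?thesis using xy nbr[of x y] \<open>e \<in> T\<close> by blast
    next
      case 2
      then have "x \<in> B \<union> D" using xy nbr[of y x] \<open>e \<in> T\<close> by (simp add: insert_commute)
      then show ?thesis using 2 xy by (metis insert_commute)
    qed
  qed
  have WBD: "W \<subseteq> B \<union> D" using Fe by (fastforce simp: W_def)
  then have finW: "finite W" by (rule finite_subset) (use B D in auto)
  have finF: "finite F" by (rule finite_subset[of _ "Pow W"]) (use finW in \<open>auto simp: W_def\<close>)
  have Fsub: "F \<subseteq> T" using core_subset by (auto simp: F_def)
  have "\<exists>x\<in>W. \<exists>y\<in>W. e = {x, y}" if eF: "e \<in> F" for e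
  proof -
    obtain x y where xy: "e = {x, y}" using Fe[OF eF] by blast
    then have "x \<in> W" "y \<in> W" using eF by (auto simp: W_def)
    then show ?thesis using xy by blast
  qed
  from card_forest_clusters[OF finW finF this no_detour_subset[OF T Fsub]]
  have FW: "card F \<le> card W" by simp
  define deg where "deg = (\<lambda>v. card {e \<in> F. v \<in> e})"
  have degsum: "(\<Sum>v\<in>W. deg v) = 2 * card F"
  proof -
    have "\<forall>e\<in>F. card {v \<in> W. v \<in> e} = 2"
    proof
      fix e assume e: "e \<in> F"
      then obtain x y where "x \<noteq> y" "e = {x, y}" using Fe by blast
      moreover have "{v \<in> W. v \<in> e} = e" using e by (auto simp: W_def)
      ultimately show "card {v \<in> W. v \<in> e} = 2" by simp
    qed
    then have "(\<Sum>v\<in>W. card {e \<in> F. v \<in> e}) = (\<Sum>e\<in>F. 2)"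
      by (intro sum_multicount_gen[OF finW finF]) auto
    then show ?thesis by (simp add: deg_def)
  qed
  have degge: "card A \<le> deg v" if "\<And>a. a \<in> A \<Longrightarrow> {v, a} \<in> core T" "v \<in> B" for v A
  proof -
    have "inj_on (\<lambda>a. {v, a}) A" by (auto simp: inj_on_def doubleton_eq_iff)
    then have "card A = card ((\<lambda>a. {v, a}) ` A)" by (simp add: card_image)
    also have "\<dots> \<le> deg v" unfolding deg_def
    proof (rule card_mono)
      show "finite {e \<in> F. v \<in> e}" using finF by simp
      show "(\<lambda>a. {v, a}) ` A \<subseteq> {e \<in> F. v \<in> e}" using that by (auto simp: F_def)
    qed
    finally show ?thesis .
  qed
  have deg2: "2 \<le> deg v" if v: "v \<in> B" "v \<in> W" for v
  proof -
    obtain e where e: "e \<in> F" "v \<in> e" using v(2) by (auto simp: W_def)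
    obtain x y where "e = {x, y}" using Fe[OF e(1)] by blast
    then have "{v, x} \<in> core T \<or> {v, y} \<in> core T" using e by (auto simp: F_def insert_commute)
    then obtain y where y: "{v, y} \<in> core T" by blast
    obtain w where w: "w \<noteq> y" "{v, w} \<in> core T" using core_no_leaf[OF T fin y] by blast
    have "card {y, w} \<le> deg v" by (rule degge) (use w y v in auto)
    then show ?thesis using w by simp
  qed
  let ?Z = "{z \<in> B. branch_point T z}"
  have Z: "z \<in> W" "3 \<le> deg z" if "z \<in> ?Z" for z
  proof -
    from that obtain a b c where abc: "a \<noteq> b" "a \<noteq> c" "b \<noteq> c" "{z, a} \<in> core T"
      "{z, b} \<in> core T" "{z, c} \<in> core T" and zB: "z \<in> B" by (auto simp: branch_point_def)
    show "z \<in> W" using abc zB by (auto simp: W_def F_def)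
    have "card {a, b, c} \<le> deg z" by (rule degge) (use abc zB in auto)
    then show "3 \<le> deg z" using abc by simp
  qed
  have "2 * card (B \<inter> W) + card ?Z = (\<Sum>v\<in>B \<inter> W. 2 + (if v \<in> ?Z then 1 else 0))"
  proof -
    have "B \<inter> W \<inter> ?Z = ?Z" using Z by auto
    then have "(\<Sum>v\<in>B \<inter> W. if v \<in> ?Z then 1 else 0) = card ?Z"
      using sum.inter_restrict[of "B \<inter> W" "\<lambda>_. 1 :: nat" ?Z] B by simp
    then show ?thesis by (simp only: sum.distrib sum_constant) simp
  qed
  also have "\<dots> \<le> (\<Sum>v\<in>B \<inter> W. deg v)"
    by (rule sum_mono) (use deg2 Z(2) in fastforce)
  also have "\<dots> \<le> (\<Sum>v\<in>W. deg v)" by (rule sum_mono2) (use finW in auto)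
  also have "\<dots> \<le> 2 * card W" using degsum FW by simp
  also have "card W = card (B \<inter> W) + card (W \<inter> D)"
    using WBD BD finW by (subst card_Un_disjoint[symmetric]) (auto intro!: arg_cong[where f = card])
  also have "card (W \<inter> D) \<le> card D" by (rule card_mono) (use D in auto)
  finally show ?thesis by simp
qed

section \<open>Branch points of random subgraphs\<close>

lemma branch_edge_map:
  assumes f: "bij f" shows "branch (edge_map f T) (f x) (f y) = f ` branch T x y"
proof (rule set_eqI)
  fix w
  obtain v where [simp]: "w = f v" using f by (rule bij_pointE)
  show "w \<in> branch (edge_map f T) (f x) (f y) \<longleftrightarrow> w \<in> f ` branch T x y"
    using f by (simp add: branch_def edge_map_Diff conn_edge_map_iff inj_image_mem_iff bij_is_inj)
qed

lemma core_edge_map: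
  assumes f: "bij f" shows "{f x, f y} \<in> core (edge_map f T) \<longleftrightarrow> {x, y} \<in> core T"
proof -
  have "finite (f ` A) \<longleftrightarrow> finite A" for A
    using f by (intro finite_image_iff) (meson bij_is_inj inj_on_subset subset_UNIV)
  then show ?thesis unfolding core_iff by (simp add: edge_map_mem_pair[OF f] branch_edge_map[OF f])
qed

lemma branch_point_edge_map:
  assumes f: "bij f" shows "branch_point (edge_map f T) (f z) \<longleftrightarrow> branch_point T z"
proof
  assume "branch_point (edge_map f T) (f z)"
  then obtain a b c where abc: "a \<noteq> b" "a \<noteq> c" "b \<noteq> c" "{f z, a} \<in> core (edge_map f T)"
    "{f z, b} \<in> core (edge_map f T)" "{f z, c} \<in> core (edge_map f T)"
    unfolding branch_point_def by blast
  obtain a' where a: "a = f a'" using f by (rule bij_pointE)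
  obtain b' where b: "b = f b'" using f by (rule bij_pointE)
  obtain c' where c: "c = f c'" using f by (rule bij_pointE)
  have "a' \<noteq> b'" "a' \<noteq> c'" "b' \<noteq> c'" using abc(1-3) a b c by auto
  moreover have "{z, a'} \<in> core T" "{z, b'} \<in> core T" "{z, c'} \<in> core T"
    using abc(4-6) unfolding a b c core_edge_map[OF f] .
  ultimately show "branch_point T z" unfolding branch_point_def by (intro exI conjI)
next
  assume "branch_point T z"
  then obtain a b c where abc: "a \<noteq> b" "a \<noteq> c" "b \<noteq> c" "{z, a} \<in> core T"
    "{z, b} \<in> core T" "{z, c} \<in> core T"
    unfolding branch_point_def by blast
  then have "f a \<noteq> f b" "f a \<noteq> f c" "f b \<noteq> f c" using f by (simp_all add: bij_is_inj inj_eq)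
  moreover have "{f z, f a} \<in> core (edge_map f T)" "{f z, f b} \<in> core (edge_map f T)"
    "{f z, f c} \<in> core (edge_map f T)"
    using abc(4-6) unfolding core_edge_map[OF f] .
  ultimately show "branch_point (edge_map f T) (f z)" unfolding branch_point_def by (intro exI conjI)
qed

lemma subgraph_of_translate_config:
  "subgraph_of \<omega> = edge_map (translate x) (subgraph_of (translate_config x \<omega>))"
proof
  show "subgraph_of \<omega> \<subseteq> edge_map (translate x) (subgraph_of (translate_config x \<omega>))"
  proof
    fix e assume e: "e \<in> subgraph_of \<omega>"
    have eq: "e = translate x ` translate (- x) ` e" by (simp add: image_image)
    have "translate (- x) ` e \<in> subgraph_of (translate_config x \<omega>)"
      using e by (simp add: subgraph_of_def translate_config_def translate_image_lattice image_image)
    then show "e \<in> edge_map (translate x) (subgraph_of (translate_config x \<omega>))" using eq by blast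
  qed
qed (auto simp: subgraph_of_def translate_config_def translate_image_lattice)

lemma branch_point_translate_config:
  "branch_point (subgraph_of \<omega>) x \<longleftrightarrow> branch_point (subgraph_of (translate_config x \<omega>)) 0"
proof -
  have "translate x 0 = x" by (simp add: translate_def)
  then show ?thesis
    using branch_point_edge_map[OF bij_translate[of x], of "subgraph_of (translate_config x \<omega>)" 0]
    by (simp flip: subgraph_of_translate_config)
qed

text \<open>
  Reachability is a countable union over the lengths of walks and their vertices.
\<close>

lemma pred_conn:
  fixes S :: "'a \<Rightarrow> (int ^ 'd::finite) set set"
  assumes "\<And>e. Measurable.pred M (\<lambda>\<omega>. e \<in> S \<omega>)"
  shows "Measurable.pred M (\<lambda>\<omega>. conn (S \<omega>) x y)"
proof -
  have "Measurable.pred M (\<lambda>\<omega>. (x, y) \<in> adjacency (S \<omega>) ^^ n)" for n y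
  proof (induction n arbitrary: y)
    case (Suc n)
    have "(\<lambda>\<omega>. (x, y) \<in> adjacency (S \<omega>) ^^ Suc n)
        = (\<lambda>\<omega>. \<exists>z. (x, z) \<in> adjacency (S \<omega>) ^^ n \<and> {z, y} \<in> S \<omega>)"
      by (auto simp: adjacency_def fun_eq_iff)
    then show ?case using Suc.IH assms by (auto intro!: pred_intros_countable pred_intros_logic)
  qed simp
  then show ?thesis unfolding conn_def rtrancl_power by (intro pred_intros_countable)
qed

lemma pred_subgraph [measurable]: "Measurable.pred config_space (\<lambda>\<omega>. e \<in> subgraph_of \<omega>)"
  by (cases "e \<in> lattice_edges") (simp_all add: subgraph_of_def pred_edge)

lemma finite_iff_box: "finite A \<longleftrightarrow> (\<exists>n. \<forall>w. w \<in> A \<longrightarrow> w \<in> box_vertices n)"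
proof
  assume "finite A"
  then obtain n where "A \<subseteq> box_vertices n" using finite_subset_box by auto
  then show "\<exists>n. \<forall>w. w \<in> A \<longrightarrow> w \<in> box_vertices n" by auto
next
  assume "\<exists>n. \<forall>w. w \<in> A \<longrightarrow> w \<in> box_vertices n"
  then obtain n where "A \<subseteq> box_vertices n" by auto
  then show "finite A" by (rule finite_subset) (rule finite_box)
qed

lemma pred_finite_branch [measurable]:
  "Measurable.pred config_space (\<lambda>\<omega>. finite (branch (subgraph_of \<omega>) x y))"
proof -
  have "Measurable.pred config_space (\<lambda>\<omega>. e \<in> subgraph_of \<omega> - {{x, y}})" for e
    by (cases "e = {x, y}") (simp_all add: pred_subgraph)
  then have [measurable]: "Measurable.pred config_space (\<lambda>\<omega>. conn (subgraph_of \<omega> - {{x, y}}) y w)" for w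
    by (rule pred_conn)
  show ?thesis unfolding finite_iff_box branch_def mem_Collect_eq by measurable
qed

lemma pred_branch_point: "Measurable.pred config_space (\<lambda>\<omega>. branch_point (subgraph_of \<omega>) z)"
  unfolding branch_point_def core_iff by measurable

section \<open>Almost sure properties of the limit\<close>

lemma finite_lattice_neighbours: "finite {y. {x, y} \<in> lattice_edges}"
proof (rule finite_subset)
  show "{y. {x, y} \<in> lattice_edges} \<subseteq> translate x ` box_vertices 1"
  proof
    fix y assume "y \<in> {y. {x, y} \<in> lattice_edges}"
    then have "{x, y} \<in> lattice_edges" by simp
    then have "\<bar>y $ i - x $ i\<bar> \<le> 1" for i
      using lattice_adj_le[of x y i] by (simp add: abs_minus_commute)
    then have "y - x \<in> box_vertices 1" by (simp add: box_vertices_def)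
    moreover have "y = translate x (y - x)" by (simp add: translate_def)
    ultimately show "y \<in> translate x ` box_vertices 1" by blast
  qed
qed (simp add: finite_box)

lemma finite_subgraph_neighbours: "finite {y. {x, y} \<in> subgraph_of \<omega>}"
  by (rule finite_subset[OF _ finite_lattice_neighbours[of x]]) (auto simp: subgraph_of_def)

lemma subgraph_of_subset: "subgraph_of \<omega> \<subseteq> lattice_edges"
  by (auto simp: subgraph_of_def)

context
  fixes \<mu> :: "((int ^ 'd::finite) set \<Rightarrow> bool) measure"
  assumes \<mu>: "is_limiting_usf \<mu>"
begin

interpretation prob_space \<mu> using \<mu> by (simp add: is_limiting_usf_def)

lemma sets_usf: "sets \<mu> = sets config_space"
  using \<mu> by (simp add: is_limiting_usf_def)

lemma space_usf: "space \<mu> = space config_space"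
  by (rule sets_eq_imp_space_eq[OF sets_usf])

lemma AE_not_in_local_event:
  assumes C: "finitely_determined C"
    and ev: "\<forall>\<^sub>F n in sequentially. \<forall>T\<in>box_spanning_trees n. config_of T \<notin> C"
  shows "AE \<omega> in \<mu>. \<omega> \<notin> C"
proof -
  have Cs: "C \<in> sets config_space" using C by (simp add: finitely_determined_def)
  have "(\<lambda>n. measure (box_ust n) C) \<longlonglongrightarrow> measure \<mu> C"
    using \<mu> C by (simp add: is_limiting_usf_def)
  moreover have "\<forall>\<^sub>F n in sequentially. measure (box_ust n) C = 0"
    using ev
  proof eventually_elim
    case (elim n)
    then have none: "{T \<in> box_spanning_trees n. config_of T \<in> C} = {}" by auto
    show ?case unfolding box_ust_measure[OF Cs] none by simp
  qed
  then have "(\<lambda>n. measure (box_ust n) C) \<longlonglongrightarrow> 0" by (rule tendsto_eventually)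
  ultimately have "measure \<mu> C = 0" by (rule LIMSEQ_unique)
  then have "C \<in> null_sets \<mu>" using Cs by (auto simp: null_sets_def sets_usf emeasure_eq_measure)
  then show ?thesis by (rule AE_not_in)
qed

text \<open>
  There are only countably many possible cycles, and no box tree contains any of them.
\<close>

lemma AE_cycle_free: "AE \<omega> in \<mu>. cycle_free (subgraph_of \<omega>)"
proof -
  have "AE \<omega> in \<mu>. \<not> is_cycle (subgraph_of \<omega>) vs" for vs
  proof -
    define F where "F = (\<lambda>i. {vs ! i, vs ! (Suc i mod length vs)}) ` {..<length vs}"
    have F: "is_cycle T vs \<longleftrightarrow> length vs \<ge> 3 \<and> distinct vs \<and> F \<subseteq> T" for T
      by (auto simp: is_cycle_def F_def)
    show ?thesis
    proof (cases "length vs \<ge> 3 \<and> distinct vs \<and> F \<subseteq> lattice_edges")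
      case True
      have fin: "finite F" by (simp add: F_def)
      have "AE \<omega> in \<mu>. \<omega> \<notin> open_cylinder F"
      proof (rule AE_not_in_local_event)
        show "finitely_determined (open_cylinder F)"
          using finitely_determined_open_cylinder[OF fin] True by simp
        have "config_of T \<notin> open_cylinder F" if "T \<in> box_spanning_trees n" for T n
        proof
          assume "config_of T \<in> open_cylinder F"
          then have "F \<subseteq> T" using True by (auto simp: open_cylinder_def config_of_apply subset_iff)
          then have "is_cycle T vs" using F True by simp
          then show False using that by (auto simp: box_spanning_trees_def cycle_free_def)
        qed
        then show "\<forall>\<^sub>F n in sequentially. \<forall>T\<in>box_spanning_trees n. config_of T \<notin> open_cylinder F"
          by simp
      qed
      then show ?thesis
      proof (rule AE_mp[OF _ AE_I2], intro impI)
        fix \<omega> assume "\<omega> \<in> space \<mu>" "\<omega> \<notin> open_cylinder F"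
        then show "\<not> is_cycle (subgraph_of \<omega>) vs"
          by (auto simp: F open_cylinder_def space_usf subgraph_of_def)
      qed
    next
      case False
      then have "\<not> is_cycle (subgraph_of \<omega>) vs" for \<omega> using subgraph_of_subset F by blast
      then show ?thesis by simp
    qed
  qed
  then show ?thesis unfolding cycle_free_def by (simp add: AE_all_countable)
qed

text \<open>
  A finite component has no edge to its complement. For a fixed finite vertex set this is impossible
  in the spanning trees of all larger boxes, and there are only countably many finite sets.
\<close>

lemma AE_infinite_components: "AE \<omega> in \<mu>. \<forall>x. infinite {w. conn (subgraph_of \<omega>) x w}"
proof -
  define D where "D S = {e \<in> lattice_edges. \<exists>x\<in>S. \<exists>y. y \<notin> S \<and> e = {x, y}}" for S :: "(int ^ 'd) set"
  define C where "C S = {\<omega> \<in> space config_space. \<forall>e\<in>D S. \<not> \<omega> e}" for S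
  let ?\<S> = "{S :: (int ^ 'd) set. finite S \<and> S \<noteq> {}}"
  have closed: "w \<in> S" if "conn T x w" "x \<in> S" "T \<subseteq> lattice_edges" "D S \<inter> T = {}" for T x w S
    using that(1)
  proof (induction rule: conn_induct)
    case (step u v)
    then show ?case using that(3,4) by (auto simp: D_def)
  qed (use that in auto)
  have "AE \<omega> in \<mu>. \<omega> \<notin> C S" if S: "S \<in> ?\<S>" for S
  proof (rule AE_not_in_local_event)
    have finD: "finite (D S)"
    proof (rule finite_subset)
      show "D S \<subseteq> (\<Union>x\<in>S. (\<lambda>y. {x, y}) ` {y. {x, y} \<in> lattice_edges})"
        by (auto simp: D_def)
    qed (use S finite_lattice_neighbours in auto)
    have DL: "D S \<subseteq> lattice_edges" by (auto simp: D_def)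
    have "{\<omega> \<in> space config_space. \<not> \<omega> e} \<in> sets config_space" if "e \<in> D S" for e
      using sets.sets_Collect_neg[OF sets_edge[of e]] DL that by auto
    then have "C S \<in> sets config_space" unfolding C_def
      by (intro sets.sets_Collect_finite_All finD)
    then show "finitely_determined (C S)" unfolding finitely_determined_def
      using finD DL by (auto simp: C_def intro!: exI[of _ "D S"])
    obtain n0 where n0: "S \<subseteq> box_vertices n0" using finite_subset_box S by auto
    obtain x where x: "x \<in> S" using S by auto
    define y :: "int ^ 'd" where "y = (\<chi> i. int n0 + 1)"
    have y: "y \<notin> S" "y \<in> box_vertices (n0 + 1)" using n0 by (auto simp: y_def box_vertices_def)
    have "config_of T \<notin> C S" if n: "n \<ge> n0 + 1" and T: "T \<in> box_spanning_trees n" for n T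
    proof
      assume "config_of T \<in> C S"
      moreover have TL: "T \<subseteq> lattice_edges" using T by (auto simp: box_spanning_trees_def box_edges_def)
      ultimately have DT: "D S \<inter> T = {}" using DL config_of_apply unfolding C_def by blast
      have "x \<in> box_vertices n" "y \<in> box_vertices n"
        using x y(2) n0 box_mono[of n0 n] box_mono[OF n] n by auto
      then have "conn T x y" using T by (simp add: box_spanning_trees_def conn_def)
      then show False using closed[OF _ x TL DT] y by blast
    qed
    then show "\<forall>\<^sub>F n in sequentially. \<forall>T\<in>box_spanning_trees n. config_of T \<notin> C S"
      unfolding eventually_sequentially by blast
  qed
  moreover have "countable ?\<S>"
    by (rule countable_subset[OF _ countable_Collect_finite]) auto
  ultimately have "AE \<omega> in \<mu>. \<forall>S\<in>?\<S>. \<omega> \<notin> C S" by (simp only: AE_ball_countable) blast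
  then show ?thesis
  proof (rule AE_mp[OF _ AE_I2], intro impI allI)
    fix \<omega> x assume \<omega>: "\<omega> \<in> space \<mu>" and no: "\<forall>S\<in>?\<S>. \<omega> \<notin> C S"
    let ?T = "subgraph_of \<omega>"
    show "infinite {w. conn ?T x w}"
    proof
      assume fin: "finite {w. conn ?T x w}"
      have "x \<in> {w. conn ?T x w}" by simp
      then have "\<omega> \<notin> C {w. conn ?T x w}" using fin no by blast
      then obtain u v where "conn ?T x u" "\<not> conn ?T x v" "{u, v} \<in> ?T"
        using \<omega> by (auto simp: C_def D_def space_usf subgraph_of_def)
      then show False using conn_step by metis
    qed
  qed
qed

lemma prob_branch_point: "prob {\<omega> \<in> space \<mu>. branch_point (subgraph_of \<omega>) x}
    = prob {\<omega> \<in> space \<mu>. branch_point (subgraph_of \<omega>) 0}"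
proof -
  let ?A = "{\<omega> \<in> space config_space. branch_point (subgraph_of \<omega>) 0}"
  have A: "?A \<in> sets config_space" using pred_branch_point by (simp add: pred_def)
  have m: "translate_config x \<in> \<mu> \<rightarrow>\<^sub>M config_space"
    unfolding measurable_cong_sets[OF sets_usf refl] by (rule measurable_translate_config)
  have "prob ?A = measure (distr \<mu> config_space (translate_config x)) ?A"
    by (simp add: limiting_usf_translate_invariant[OF \<mu>])
  also have "\<dots> = prob (translate_config x -` ?A \<inter> space \<mu>)" by (rule measure_distr[OF m A])
  also have "translate_config x -` ?A \<inter> space \<mu> = {\<omega> \<in> space \<mu>. branch_point (subgraph_of \<omega>) x}"
    using measurable_space[OF m] by (auto simp: branch_point_translate_config[of _ x])
  finally show ?thesis by (simp add: space_usf)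
qed

lemma card_box: "card (box_vertices n :: (int ^ 'd) set) = (2 * n + 1) ^ CARD('d)"
proof -
  have "bij_betw vec_nth (box_vertices n :: (int ^ 'd) set) (PiE UNIV (\<lambda>_. {- int n..int n}))"
  proof (rule bij_betwI[where g = vec_lambda])
    show "vec_nth \<in> box_vertices n \<rightarrow> (UNIV :: 'd set) \<rightarrow>\<^sub>E {- int n..int n}"
      by (auto simp: box_vertices_def abs_le_iff minus_le_iff)
    show "vec_lambda \<in> ((UNIV :: 'd set) \<rightarrow>\<^sub>E {- int n..int n}) \<rightarrow> box_vertices n"
    proof
      fix f :: "'d \<Rightarrow> int" assume f: "f \<in> UNIV \<rightarrow>\<^sub>E {- int n..int n}"
      have "\<bar>f i\<bar> \<le> int n" for i using PiE_mem[OF f, of i] by auto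
      then show "vec_lambda f \<in> box_vertices n" by (simp add: box_vertices_def)
    qed
  qed (auto simp: vec_lambda_inverse)
  then have "card (box_vertices n :: (int ^ 'd) set) = card (PiE (UNIV :: 'd set) (\<lambda>_. {- int n..int n}))"
    by (rule bij_betw_same_card)
  also have "\<dots> = (2 * n + 1) ^ CARD('d)" by (simp add: card_PiE nat_add_distrib nat_mult_distrib)
  finally show ?thesis .
qed

text \<open>
  The left-hand side is the expected number of branch points in the box, by translation invariance.
\<close>

lemma prob_branch_point_bound:
  "real (card (box_vertices n :: (int ^ 'd) set)) * prob {\<omega> \<in> space \<mu>. branch_point (subgraph_of \<omega>) 0}
    \<le> 2 * real (card (box_vertices (Suc n) - box_vertices n :: (int ^ 'd) set))"
proof -
  let ?B = "box_vertices n :: (int ^ 'd) set"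
  let ?D = "box_vertices (Suc n) - box_vertices n :: (int ^ 'd) set"
  define E where "E x = {\<omega> \<in> space \<mu>. branch_point (subgraph_of \<omega>) x}" for x
  have E: "E x \<in> events" for x
    using pred_branch_point by (simp add: E_def sets_usf space_usf pred_def)
  have "(\<Sum>x\<in>?B. prob (E x)) = (\<Sum>x\<in>?B. prob (E 0))"
    unfolding E_def by (rule sum.cong[OF refl]) (rule prob_branch_point)
  then have "real (card ?B) * prob (E 0) = (\<Sum>x\<in>?B. prob (E x))" by simp
  also have "\<dots> = (\<Sum>x\<in>?B. \<integral>\<omega>. indicator (E x) \<omega> \<partial>\<mu>)"
    using E by (intro sum.cong) (auto simp: integral_indicator sets.Int_space_eq2)
  also have "\<dots> = (\<integral>\<omega>. (\<Sum>x\<in>?B. indicator (E x) \<omega>) \<partial>\<mu>)"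
    by (rule Bochner_Integration.integral_sum[symmetric]) (use E in \<open>simp add: emeasure_eq_measure\<close>)
  also have "\<dots> \<le> (\<integral>\<omega>. 2 * real (card ?D) \<partial>\<mu>)"
  proof (rule integral_mono_AE)
    show "integrable \<mu> (\<lambda>\<omega>. \<Sum>x\<in>?B. indicator (E x) \<omega> :: real)"
      by (rule Bochner_Integration.integrable_sum) (use E in \<open>simp add: emeasure_eq_measure\<close>)
    show "AE \<omega> in \<mu>. (\<Sum>x\<in>?B. indicator (E x) \<omega>) \<le> 2 * real (card ?D)"
      using AE_cycle_free AE_space
    proof eventually_elim
      case (elim \<omega>)
      let ?T = "subgraph_of \<omega>"
      have T: "no_detour ?T" "simple_edges ?T"
        using elim cycle_free_iff_no_detour simple_edges_lattice[OF subgraph_of_subset] by auto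
      have "card {z \<in> ?B. branch_point ?T z} \<le> 2 * card ?D"
      proof (rule card_branch_points_le[OF T finite_subgraph_neighbours finite_box])
        show "finite ?D" by (simp add: finite_box)
        fix x y assume x: "x \<in> ?B" and "{x, y} \<in> ?T"
        then have e: "{x, y} \<in> lattice_edges" using subgraph_of_subset by auto
        have "\<bar>y $ i\<bar> \<le> int (Suc n)" for i
        proof -
          have "\<bar>x $ i\<bar> \<le> int n" using x by (simp add: box_vertices_def)
          then show ?thesis using lattice_adj_le[OF e, of i] by linarith
        qed
        then have "y \<in> box_vertices (Suc n)" unfolding box_vertices_def by blast
        then show "y \<in> ?B \<union> ?D" by blast
      qed auto
      moreover have "(\<Sum>x\<in>?B. indicator (E x) \<omega> :: real) = real (card {z \<in> ?B. branch_point ?T z})"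
      proof -
        have "(\<Sum>x\<in>?B. indicator (E x) \<omega> :: real) = (\<Sum>x\<in>?B. if branch_point ?T x then 1 else 0)"
          using elim by (intro sum.cong) (auto simp: E_def indicator_def)
        also have "\<dots> = real (card {z \<in> ?B. branch_point ?T z})"
          by (simp flip: sum.inter_filter[OF finite_box])
        finally show ?thesis .
      qed
      ultimately show ?case by linarith
    qed
  qed simp
  also have "\<dots> = 2 * real (card ?D)" by (simp add: prob_space)
  finally show ?thesis by (simp add: E_def)
qed

text \<open>
  The ratio of the volumes of the boxes of radii \<open>Suc n\<close> and \<open>n\<close> tends to 1.
\<close>

lemma prob_branch_point_zero: "prob {\<omega> \<in> space \<mu>. branch_point (subgraph_of \<omega>) x} = 0"
proof -
  let ?M = "prob {\<omega> \<in> space \<mu>. branch_point (subgraph_of \<omega>) 0}"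
  let ?r = "\<lambda>n. 1 + 2 * inverse (real (Suc (2 * n)))"
  have bound: "?M \<le> 2 * (?r n ^ CARD('d) - 1)" for n
  proof -
    let ?a = "real (2 * n + 1)" and ?b = "real (2 * Suc n + 1)"
    have sub: "box_vertices n \<subseteq> (box_vertices (Suc n) :: (int ^ 'd) set)" by (rule box_mono) simp
    have "real (card (box_vertices (Suc n) - box_vertices n :: (int ^ 'd) set)) = ?b ^ CARD('d) - ?a ^ CARD('d)"
      using card_Diff_subset[OF finite_box sub] card_mono[OF finite_box sub]
      by (simp add: card_box of_nat_diff del: of_nat_Suc of_nat_add of_nat_mult)
    then have "?a ^ CARD('d) * ?M \<le> 2 * (?b ^ CARD('d) - ?a ^ CARD('d))"
      using prob_branch_point_bound[of n] by (simp only: card_box of_nat_power)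
    moreover have "?b = ?r n * ?a" by (simp add: field_simps)
    then have "?b ^ CARD('d) = ?r n ^ CARD('d) * ?a ^ CARD('d)" by (simp only: power_mult_distrib)
    ultimately have "?a ^ CARD('d) * ?M \<le> ?a ^ CARD('d) * (2 * (?r n ^ CARD('d) - 1))"
      by (simp add: algebra_simps)
    moreover have "?a ^ CARD('d) > 0" by simp
    ultimately show ?thesis by (simp only: mult_le_cancel_left_pos)
  qed
  have "(\<lambda>n. inverse (real (Suc (2 * n)))) \<longlonglongrightarrow> 0"
    using LIMSEQ_subseq_LIMSEQ[OF LIMSEQ_inverse_real_of_nat, of "\<lambda>n. 2 * n"]
    by (simp add: strict_mono_def o_def)
  then have "(\<lambda>n. 2 * (?r n ^ CARD('d) - 1)) \<longlonglongrightarrow> 2 * ((1 + 2 * 0) ^ CARD('d) - 1)"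
    by (intro tendsto_intros)
  then have "?M \<le> 2 * ((1 + 2 * 0) ^ CARD('d) - 1)"
    by (rule LIMSEQ_le_const) (use bound in blast)
  then have "?M = 0" using measure_nonneg[of \<mu>] by (simp add: antisym)
  then show ?thesis using prob_branch_point by simp
qed

lemma AE_no_branch_point: "AE \<omega> in \<mu>. \<forall>x. \<not> branch_point (subgraph_of \<omega>) x"
proof -
  have "AE \<omega> in \<mu>. \<not> branch_point (subgraph_of \<omega>) x" for x
  proof -
    have "{\<omega> \<in> space \<mu>. branch_point (subgraph_of \<omega>) x} \<in> events"
      using pred_branch_point by (simp add: sets_usf space_usf pred_def)
    then have "{\<omega> \<in> space \<mu>. branch_point (subgraph_of \<omega>) x} \<in> null_sets \<mu>"
      using prob_branch_point_zero by (auto simp: null_sets_def emeasure_eq_measure)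
    from AE_not_in[OF this] AE_space show ?thesis by eventually_elim auto
  qed
  then show ?thesis by (simp add: AE_all_countable)
qed

end

theorem mainTheorem4:
  fixes \<mu> :: "((int ^ 'd::finite) set \<Rightarrow> bool) measure"
  assumes "CARD('d) \<ge> 5"
    and "is_limiting_usf \<mu>"
  shows "AE \<omega> in \<mu>. spanning_forest (subgraph_of \<omega>) \<and>
    (\<forall>C\<in>components_of (subgraph_of \<omega>).
       has_ends (subgraph_of \<omega>) C 1 \<or> has_ends (subgraph_of \<omega>) C 2)"
  using AE_cycle_free[OF assms(2)] AE_infinite_components[OF assms(2)] AE_no_branch_point[OF assms(2)]
proof eventually_elim
  case (elim \<omega>)
  let ?T = "subgraph_of \<omega>"
  have T: "no_detour ?T"
    using elim(1) cycle_free_iff_no_detour[OF simple_edges_lattice[OF subgraph_of_subset]] by blast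
  have inf: "infinite {w. conn ?T x w}" for x using elim(2) by blast
  have "\<exists>e\<in>?T. x \<in> e" for x
  proof -
    obtain p where "p \<in> rays_from ?T x"
      using ray_exists[OF T finite_subgraph_neighbours inf] by blast
    then have "p 0 = x" "{p 0, p (Suc 0)} \<in> ?T" by (auto simp: rays_from_def)
    then show ?thesis by blast
  qed
  then have "spanning_forest ?T" using elim(1) subgraph_of_subset by (auto simp: spanning_forest_def)
  moreover have "has_ends ?T C 1 \<or> has_ends ?T C 2" if "C \<in> components_of ?T" for C
    using has_ends_one_or_two[OF T finite_subgraph_neighbours inf _ that] elim(3) by blast
  ultimately show ?case by blast
qed

end
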